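(* Let $\varphi,\psi$ be two moment profiles with $r\le \psi(r)\le\varphi(r)$ for all $r>1$. Let $(p_n)_{n\ge1}$ be positive reals and $(v_n)_{n\ge 1}$ reals, and for $t\in\mathbb{C}$ let $$\mu_t=\sum_{n=1}^\infty\Big[\frac{p_n}{2}\,\delta_{S_{v_n-t}}+\frac{p_n}{2}\,\delta_{S_{-v_n-t}}\Big].$$ Assume: (i) $\sum_{n\ge1}p_n=1$ and $0<\limsup_{n\to\infty}\frac{p_{n-1}}{p_n}\le 1$; (ii) $v_n>0$ and $v_{n+1}-v_n>4$ for every $n\ge1$, and $\lim_{n\to\infty}v_n=\lim_{n\to\infty}(v_n-v_{n-1})=\infty$; (iii) the measures $\mu_t$ have locally uniformly bounded $\psi$-moments, i.e. $\sup_{|t|\le m}\int\psi(\log\|g\|)\,d\mu_t(g)<\infty$ for every $m>0$; (iv) $\lim_{n\to\infty}p_n\,\varphi(\log v_n)=\infty$ (which implies that the measures $\mu_t$ do not have finite $\varphi$-moments). Then the integrated density of states $\mathbb{R}\ni E\mapsto N(E)$, i.e. the fibered rotation number of the Schrödinger cocycle, does not have $\omega=\mathscr{T}_2(\varphi)$, $\omega(r)=\varphi(\log\tfrac1r)^{-2}$, as a local modulus of continuity.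
   Context: For $v\in\mathbb{C}$, $S_v=\begin{bmatrix} v&-1\\1&0\end{bmatrix}$. A moment profile is a continuous, strictly increasing function $\varphi:(1,+\infty)\to(0,+\infty)$ with $\lim_{r\to\infty}\varphi(r)=\infty$. A probability measure $\mu$ on matrices of determinant $1$ has finite $\varphi$-moment if $\int\varphi(\log\|g\|)\,d\mu(g)<\infty$ (the integral is over the $g$ with $\log\|g\|>1$; the remaining $g$ are irrelevant for finiteness). A modulus of continuity is a continuous, strictly increasing $\omega:[0,1)\to[0,\infty)$ with $\omega(0)=0$ (only values near $0$ matter). For $\beta>0$, $\mathscr{T}_\beta(\varphi)$ is the modulus $\omega(r)=\varphi(\log\frac1r)^{-\beta}$ for small $r>0$, $\omega(0)=0$. A function $f:X\to\mathbb{R}$ on a metric space $(X,d)$ has local modulus of continuity $\omega$ if for every $a\in X$ there are $r>0$ and $C<\infty$ such that $|f(x)-f(y)|\le C\,\omega(d(x,y))$ whenever $d(x,a)<r$ and $d(y,a)<r$. The Lyapunov exponent is $L_1(\mu_t)=\lim_{n\to\infty}\frac1n\int\log\|g\|\,d\mu_t^{n}(g)$, where $\mu_t^{n}$ is the $n$-th convolution power. The integrated density of states (IDS) $N$ is the unique distribution function (continuous, non-decreasing, with limits $0$ at $-\infty$ and $1$ at $+\infty$) for which the Thouless formula $L_1(\mu_t)=\int\log|t-s|\,dN(s)$ holds for all $t\in\mathbb{C}$. It agrees with the asymptotic eigenvalue distribution of truncations to long intervals of the operator $(H_\omega\zeta)_n=-(\zeta_{n+1}+\zeta_{n-1})+\omega_n\zeta_n$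 with $(\omega_n)_{n\in\mathbb{Z}}$ i.i.d. of law $\nu=\sum_n\frac{p_n}{2}(\delta_{v_n}+\delta_{-v_n})$, and with the fibered rotation number $N(E_0)=\lim_{n\to\infty}K_n(\omega,E_0)/n$, where for a.e. $\omega$ and any $\hat v\in\mathbb{P}^1$, $K_n(\omega,E_0)$ is the number of full turns in $\mathbb{P}^1$ of the curve $(-\infty,E_0]\ni E\mapsto A_E^n(\omega)\hat v$, with $A_E^n(\omega)=S_{\omega_{n-1}-E}\cdots S_{\omega_0-E}$. *)

theory Defs
  imports "HOL-Probability.Probability"
begin

definition schroedinger_matrix :: "complex \<Rightarrow> complex^2^2" where
  "schroedinger_matrix v = vector [vector [v, -1], vector [1, 0]]"

abbreviation opnorm :: "complex^2^2 \<Rightarrow> real" where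
  "opnorm g \<equiv> onorm ((*v) g)"

text \<open>Sequences are indexed by \<open>n \<ge> 1\<close>; their values at \<open>0\<close> are never used.\<close>

definition schroedinger_measure ::
    "(nat \<Rightarrow> real) \<Rightarrow> (nat \<Rightarrow> real) \<Rightarrow> complex \<Rightarrow> (complex^2^2) measure" where
  "schroedinger_measure p v t = measure_of UNIV (sets borel)
     (\<lambda>A. \<Sum>n. ennreal (p (Suc n) / 2)
              * indicator A (schroedinger_matrix (complex_of_real (v (Suc n)) - t))
            + ennreal (p (Suc n) / 2)
              * indicator A (schroedinger_matrix (- complex_of_real (v (Suc n)) - t)))"

lemma sets_schroedinger_measure [simp]: "sets (schroedinger_measure p v t) = sets borel"
  unfolding schroedinger_measure_def
  using sets.sets_measure_of_eq[of borel] by simp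

text \<open>The set function above is countably additive, so the measure really is given by the sum.\<close>

lemma emeasure_schroedinger_measure:
  assumes "A \<in> sets borel"
  shows "emeasure (schroedinger_measure p v t) A =
     (\<Sum>n. ennreal (p (Suc n) / 2)
              * indicator A (schroedinger_matrix (complex_of_real (v (Suc n)) - t))
            + ennreal (p (Suc n) / 2)
              * indicator A (schroedinger_matrix (- complex_of_real (v (Suc n)) - t)))"
proof (rule emeasure_measure_of[OF schroedinger_measure_def])
  let ?m = "\<lambda>A. \<Sum>n. ennreal (p (Suc n) / 2)
              * indicator A (schroedinger_matrix (complex_of_real (v (Suc n)) - t))
            + ennreal (p (Suc n) / 2)
              * indicator A (schroedinger_matrix (- complex_of_real (v (Suc n)) - t))"
  show "positive (sets (schroedinger_measure p v t)) ?m"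
    by (simp add: positive_def)
  show "countably_additive (sets (schroedinger_measure p v t)) ?m"
    unfolding countably_additive_def
  proof (intro allI impI)
    fix B :: "nat \<Rightarrow> (complex^2^2) set"
    assume d: "disjoint_family B"
    have c: "(\<Sum>i. a * indicator (B i) x + a * indicator (B i) y)
        = a * indicator (\<Union>i. B i) x + a * indicator (\<Union>i. B i) y" for a :: ennreal and x y
      by (subst suminf_add[symmetric])
         (simp_all only: summableI ennreal_suminf_cmult suminf_indicator[OF d])
    have swap: "(\<Sum>i. \<Sum>n. F i n) = (\<Sum>n. \<Sum>i. F i n)" for F :: "nat \<Rightarrow> nat \<Rightarrow> ennreal"
      using nn_integral_suminf[of F "count_space UNIV"]
      by (simp add: nn_integral_count_space_nat)
    show "(\<Sum>i. ?m (B i)) = ?m (\<Union>i. B i)"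
      by (subst swap) (simp only: c)
  qed
next
  show "A \<in> sets (schroedinger_measure p v t)"
    using assms by simp
qed simp_all

definition moment_profile :: "(real \<Rightarrow> real) \<Rightarrow> bool" where
  "moment_profile \<phi> \<longleftrightarrow>
     continuous_on {1<..} \<phi> \<and> strict_mono_on {1<..} \<phi> \<and> (\<forall>r>1. \<phi> r > 0) \<and>
     filterlim \<phi> at_top at_top"

definition moment :: "(real \<Rightarrow> real) \<Rightarrow> (complex^2^2) measure \<Rightarrow> ennreal" where
  "moment \<phi> M = (\<integral>\<^sup>+ g\<in>{g. ln (opnorm g) > 1}. ennreal (\<phi> (ln (opnorm g))) \<partial>M)"

text \<open>Only the germ of this function at \<open>0\<close> is meaningful: \<open>\<phi>\<close> need only be a moment
  profile on \<open>(1, \<infinity>)\<close>, so the formula defines a modulus of continuity for \<open>0 \<le> r < exp (- 1)\<close>.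
  The notion of local modulus below depends only on this germ, as the radius may be shrunk.\<close>

definition profile_modulus :: "real \<Rightarrow> (real \<Rightarrow> real) \<Rightarrow> real \<Rightarrow> real" where
  "profile_modulus \<beta> \<phi> r = (if r = 0 then 0 else \<phi> (ln (1 / r)) powr (- \<beta>))"

definition has_local_modulus :: "('a::metric_space \<Rightarrow> real) \<Rightarrow> (real \<Rightarrow> real) \<Rightarrow> bool" where
  "has_local_modulus f \<omega> \<longleftrightarrow>
     (\<forall>a. \<exists>r>0. \<exists>C. \<forall>x y. dist x a < r \<and> dist y a < r \<longrightarrow> \<bar>f x - f y\<bar> \<le> C * \<omega> (dist x y))"

definition mult_convolution ::
    "(complex^2^2) measure \<Rightarrow> (complex^2^2) measure \<Rightarrow> (complex^2^2) measure" where
  "mult_convolution M N = distr (M \<Otimes>\<^sub>M N) borel (\<lambda>(g, h). g ** h)"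

primrec convolution_power :: "(complex^2^2) measure \<Rightarrow> nat \<Rightarrow> (complex^2^2) measure" where
  "convolution_power M 0 = return borel (mat 1)"
| "convolution_power M (Suc n) = mult_convolution M (convolution_power M n)"

definition lyapunov_exponent :: "(complex^2^2) measure \<Rightarrow> real" where
  "lyapunov_exponent M = lim (\<lambda>n. 1 / real n * (\<integral>g. ln (opnorm g) \<partial>convolution_power M n))"

text \<open>\<open>N\<close> is the integrated density of states of \<open>p, v\<close>: the distribution function satisfying the
  Thouless formula. Integrability is required explicitly, since the Bochner integral of a
  non-integrable function is \<open>0\<close>. For real \<open>t\<close> the convention \<open>ln 0 = 0\<close> is harmless: \<open>N\<close> is
  continuous, so \<open>s = t\<close> is a null set.\<close>

definition is_integrated_density_of_states ::
    "(nat \<Rightarrow> real) \<Rightarrow> (nat \<Rightarrow> real) \<Rightarrow> (real \<Rightarrow> real) \<Rightarrow> bool" where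
  "is_integrated_density_of_states p v N \<longleftrightarrow>
     continuous_on UNIV N \<and> mono N \<and> (N \<longlongrightarrow> 0) at_bot \<and> (N \<longlongrightarrow> 1) at_top \<and>
     (\<forall>t::complex.
        integrable (interval_measure N) (\<lambda>s. ln (cmod (t - complex_of_real s))) \<and>
        lyapunov_exponent (schroedinger_measure p v t) =
          (\<integral>s. ln (cmod (t - complex_of_real s)) \<partial>interval_measure N))"

end

theory Submission
  imports Defs
    "HOL-Computational_Algebra.Fundamental_Theorem_Algebra"
    "HOL-Real_Asymp.Real_Asymp"
begin

text \<open>
  The density of states has too much mass near \<open>E = v\<^sub>1\<close>. Fix \<open>k\<close> with \<open>U = v\<^sub>k \<ge> E + 40\<close>, let \<open>V = v\<^sub>n\<close> be large,
  and look for the block \<open>(U, V, E, -V, U)\<close> in the random potential. A vector concentrated on the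
  middle site, with small entries at the walls \<open>\<plusminus>V\<close> and even smaller ones at the outer sites, is an
  eigenvector for the energy \<open>E\<close> up to an error of less than \<open>1 / (5 V)\<close> (\<open>resonant_block_estimates\<close>). This gives
  a window of energies of length \<open>1 / V\<close>. With the two walls alone the error would be about \<open>\<surd>2 / V\<close> and the window longer than \<open>1 / V\<close>;
  since \<open>\<phi>\<close> may grow arbitrarily fast, such a constant factor cannot be absorbed by the modulus. The outer sites
  remove it at the price of a constant factor in the probability.

  The block has probability at least \<open>const \<cdot> p\<^sub>n\<^sup>2\<close>, because two of its five letters depend on \<open>n\<close>. Disjoint blocks have orthogonal
  test vectors, so the number of eigenvalues of a long truncation within \<open>1 / (2 V)\<close> of \<open>E\<close> is
  at least a fixed fraction of the number of blocks (\<open>spectral_mass_lower_bound\<close>), whence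
  \<open>N (E + 1 / (2 V)) - N (E - 1 / (2 V)) \<ge> const \<cdot> p\<^sub>n\<^sup>2\<close> (\<open>ids_window_lower_bound\<close>). A local modulus \<open>\<phi>(ln (1 / r))\<^sup>-\<^sup>2\<close> at \<open>E\<close>
  would bound the left-hand side by \<open>C \<phi>(ln V)\<^sup>-\<^sup>2\<close>, so \<open>p\<^sub>n \<phi>(ln v\<^sub>n)\<close> would stay bounded.

  It remains to relate \<open>N\<close>, which is given through the Thouless formula, to eigenvalues. The upper left
  entry of the transfer matrix is \<open>det (H - t)\<close>, and for \<open>Im t > 0\<close> it is comparable to the norm of the
  matrix (\<open>opnorm_transfer_le\<close>). Hence the expected logarithmic potentials of the normalised eigenvalue
  counting measures converge to that of \<open>N\<close> at all such \<open>t\<close> (\<open>ln_continuant_tendsto\<close>). The potential at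
  \<open>x + 2iy\<close> minus the one at \<open>x + iy\<close> is, up to the factor \<open>\<pi> y\<close>, the convolution of the measure with a positive approximate identity; its
  integral over \<open>x\<close> in an interval gives the mass of a smoothed interval (\<open>ids_smooth_window_limit\<close>).
\<close>

section \<open>Continuants and the spectrum of a finite Jacobi matrix\<close>

text \<open>The pair \<open>(P\<^sub>n, P\<^sub>n\<^sub>-\<^sub>1)\<close> with \<open>P\<^sub>n(t) = det (H\<^sub>n - t)\<close>, where \<open>H\<^sub>n\<close> is the \<open>n \<times> n\<close> Jacobi
  matrix with diagonal \<open>a 0, \<dots>, a (n - 1)\<close> and off-diagonal entries \<open>-1\<close>. Carrying the
  pair, with \<open>P\<^sub>-\<^sub>1 = 0\<close>, makes the three-term recurrence valid from the first step on.\<close>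

definition continuants :: "(nat \<Rightarrow> real) \<Rightarrow> nat \<Rightarrow> complex poly \<times> complex poly" where
  "continuants a n = rec_nat (1, 0) (\<lambda>k (P, Q). ([:of_real (a k), -1:] * P - Q, P)) n"

definition continuant :: "(nat \<Rightarrow> real) \<Rightarrow> nat \<Rightarrow> complex poly" where
  "continuant a n = fst (continuants a n)"

definition prev_continuant :: "(nat \<Rightarrow> real) \<Rightarrow> nat \<Rightarrow> complex poly" where
  "prev_continuant a n = snd (continuants a n)"

lemma continuant_0 [simp]: "continuant a 0 = 1" "prev_continuant a 0 = 0"
  by (simp_all add: continuant_def prev_continuant_def continuants_def)

lemma continuant_Suc:
  "continuant a (Suc k) = [:of_real (a k), -1:] * continuant a k - prev_continuant a k"
  "prev_continuant a (Suc k) = continuant a k"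
  by (simp_all add: continuant_def prev_continuant_def continuants_def split: prod.splits)

lemma continuant_cong:
  assumes "\<And>k. k < n \<Longrightarrow> a k = b k"
  shows "continuant a n = continuant b n \<and> prev_continuant a n = prev_continuant b n"
  using assms by (induction n) (auto simp: continuant_Suc)

lemma degree_continuant:
  "degree (continuant a n) = n \<and> coeff (continuant a n) n = (-1) ^ n
   \<and> (n > 0 \<longrightarrow> degree (prev_continuant a n) < n)"
proof (induction n)
  case (Suc n)
  let ?p = "[:of_real (a n), -1:] * continuant a n" and ?q = "prev_continuant a n"
  have IH: "degree (continuant a n) = n" "coeff (continuant a n) n = (-1) ^ n" using Suc by auto
  have nz: "continuant a n \<noteq> 0" using IH(2) by auto
  have d: "degree ?p = Suc n"
    using nz IH by (subst degree_mult_eq) auto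
  have l: "coeff ?p (Suc n) = (-1) ^ Suc n"
    using IH coeff_eq_0[of "continuant a n" "Suc n"] by simp
  have q: "degree ?q < Suc n"
    using Suc by (cases "n = 0") auto
  have "degree (?p - ?q) = Suc n"
    using degree_add_eq_left[of "- ?q" ?p] d q by simp
  moreover have "coeff (?p - ?q) (Suc n) = (-1) ^ Suc n"
    using l q coeff_eq_0[of ?q "Suc n"] by simp
  ultimately show ?case using IH unfolding continuant_Suc by simp
qed simp

text \<open>The continuants at a real point, as real numbers: up to the boundary condition at \<open>n\<close> they
  are the coordinates of an eigenvector of the Jacobi matrix.\<close>

primrec solution_pair :: "(nat \<Rightarrow> real) \<Rightarrow> real \<Rightarrow> nat \<Rightarrow> real \<times> real" where
  "solution_pair a x 0 = (1, 0)"
| "solution_pair a x (Suc k) = ((a k - x) * fst (solution_pair a x k) - snd (solution_pair a x k), fst (solution_pair a x k))"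

abbreviation sol where "sol a x k \<equiv> fst (solution_pair a x k)"

lemma continuant_of_real:
  "poly (continuant a k) (of_real x) = of_real (fst (solution_pair a x k))
   \<and> poly (prev_continuant a k) (of_real x) = of_real (snd (solution_pair a x k))"
  by (induction k) (auto simp: continuant_Suc algebra_simps)

text \<open>The diagonal Christoffel-Darboux formula. At a common zero of \<open>P\<^sub>n\<close> and its derivative the
  left-hand side vanishes, whereas at a real point and for \<open>n > 0\<close> the right-hand side is at most
  \<open>-P\<^sub>0\<^sup>2 = -1\<close>; this is why the eigenvalues are simple.\<close>

lemma continuant_wronskian:
  "poly (pderiv (continuant a n) * prev_continuant a n - continuant a n * pderiv (prev_continuant a n)) z
   = - (\<Sum>i<n. (poly (continuant a i) z)\<^sup>2)"
proof (induction n)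
  case (Suc n)
  have d: "poly (pderiv (continuant a (Suc n))) z
      = (of_real (a n) - z) * poly (pderiv (continuant a n)) z - poly (continuant a n) z
        - poly (pderiv (prev_continuant a n)) z"
    unfolding continuant_Suc pderiv_diff pderiv_mult poly_diff poly_add poly_mult
    by (simp add: pderiv_pCons algebra_simps)
  have c: "poly (continuant a (Suc n)) z
      = (of_real (a n) - z) * poly (continuant a n) z - poly (prev_continuant a n) z"
    by (simp add: continuant_Suc algebra_simps)
  show ?case
    using Suc unfolding poly_diff poly_mult d c continuant_Suc(2)
    by (simp add: algebra_simps power2_eq_square)
qed simp

text \<open>At two distinct eigenvalues the right-hand side vanishes, so the eigenvectors are orthogonal.\<close>

lemma christoffel_darboux:
  "(y - x) * (\<Sum>i<n. sol a x i * sol a y i) = sol a x n * snd (solution_pair a y n) - snd (solution_pair a x n) * sol a y n"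
  by (induction n) (auto simp: algebra_simps)

text \<open>The current \<open>Im (w \<cdot> cnj w')\<close> of a solution of the difference equation is conserved for real
  \<open>t\<close>. For \<open>Im t > 0\<close> it decreases at every site where \<open>w\<close> is nonzero. Since it vanishes
  wherever \<open>w\<close> does, it controls the zeros of a solution.\<close>

lemma im_flux:
  fixes w w' :: "nat \<Rightarrow> complex"
  assumes "\<And>k. w (Suc k) = (of_real (a k) - t) * w k - w' k" "\<And>k. w' (Suc k) = w k"
  shows "Im (w n * cnj (w' n)) = Im (w 0 * cnj (w' 0)) - Im t * (\<Sum>k<n. (cmod (w k))\<^sup>2)"
proof (induction n)
  case (Suc n)
  have "Im (w (Suc n) * cnj (w' (Suc n))) = Im (w n * cnj (w' n)) - Im t * (cmod (w n))\<^sup>2"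
    unfolding assms cmod_power2 by (simp add: algebra_simps power2_eq_square)
  then show ?case using Suc by (simp add: algebra_simps)
qed simp

lemma continuant_flux:
  "Im (poly (continuant a n) t * cnj (poly (prev_continuant a n) t))
     = - Im t * (\<Sum>k<n. (cmod (poly (continuant a k) t))\<^sup>2)"
  using im_flux[of "\<lambda>n. poly (continuant a n) t" a t "\<lambda>n. poly (prev_continuant a n) t" n]
  by (simp add: continuant_Suc algebra_simps)

lemma sum_continuant_ge_1:
  assumes "n > 0" shows "(\<Sum>k<n. (cmod (poly (continuant a k) t))\<^sup>2) \<ge> 1"
  using member_le_sum[of 0 "{..<n}" "\<lambda>k. (cmod (poly (continuant a k) t))\<^sup>2"] assms by simp

lemma continuant_nonreal:
  assumes "Im t \<noteq> 0" shows "poly (continuant a n) t \<noteq> 0"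
proof (cases "n = 0")
  case False
  then show ?thesis
    using continuant_flux[of a n t] sum_continuant_ge_1[of n a t] assms by auto
qed simp

definition spectrum :: "(nat \<Rightarrow> real) \<Rightarrow> nat \<Rightarrow> real set" where
  "spectrum a n = {x. sol a x n = 0}"

text \<open>Nonreal roots are excluded by the current: it would vanish at such a root, although it has
  accumulated the contribution of \<open>P\<^sub>0 = 1\<close>.\<close>

lemma roots_continuant:
  "{z. poly (continuant a n) z = 0} = complex_of_real ` spectrum a n"
proof -
  have "z \<in> complex_of_real ` spectrum a n" if "poly (continuant a n) z = 0" for z
  proof -
    have "Im z = 0" using that continuant_nonreal by blast
    then have z: "z = of_real (Re z)" by (simp add: complex_eq_iff)
    then have "Re z \<in> spectrum a n"
      using that continuant_of_real[of a n "Re z"] unfolding spectrum_def by simp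
    then show ?thesis using z by blast
  qed
  then show ?thesis by (auto simp: spectrum_def continuant_of_real)
qed

lemma rsquarefree_continuant: "rsquarefree (continuant a n)"
  unfolding rsquarefree_roots
proof (intro allI notI)
  fix z assume z: "poly (continuant a n) z = 0 \<and> poly (pderiv (continuant a n)) z = 0"
  then have "z \<in> complex_of_real ` spectrum a n" using roots_continuant by blast
  then obtain x where x: "z = of_real x" by blast
  have n: "n > 0" using z by (cases n) auto
  have "(\<Sum>i<n. (poly (continuant a i) z)\<^sup>2) = of_real (\<Sum>i<n. (sol a x i)\<^sup>2)"
    by (simp add: x continuant_of_real)
  moreover have "(\<Sum>i<n. (poly (continuant a i) z)\<^sup>2) = 0"
    using continuant_wronskian[of a n z] z by simp
  ultimately have "(\<Sum>i<n. (sol a x i)\<^sup>2) = 0" by (metis of_real_eq_0_iff)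
  moreover have "(\<Sum>i<n. (sol a x i)\<^sup>2) \<ge> (sol a x 0)\<^sup>2"
    using member_le_sum[of 0 "{..<n}" "\<lambda>k. (sol a x k)\<^sup>2"] n by simp
  ultimately show False by simp
qed

text \<open>Simplicity of the roots gives exactly \<open>n\<close> of them, so that the logarithm of \<open>|P\<^sub>n|\<close> is the
  logarithmic potential of the counting measure of the eigenvalues.\<close>

lemma continuant_factorization:
  shows finite_spectrum: "finite (spectrum a n)"
    and card_spectrum: "card (spectrum a n) = n"
    and cmod_continuant: "cmod (poly (continuant a n) t) = (\<Prod>x\<in>spectrum a n. cmod (t - of_real x))"
proof -
  let ?p = "continuant a n" and ?S = "spectrum a n"
  have nz: "?p \<noteq> 0" using degree_continuant[of a n] by auto
  show fin: "finite ?S"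
    using poly_roots_finite[OF nz] unfolding roots_continuant
    by (rule finite_imageD) (simp add: inj_on_def)
  have "(\<Prod>z\<in>complex_of_real ` ?S. [:- z, 1:]) = (\<Prod>x\<in>?S. [:- complex_of_real x, 1:])"
    by (subst prod.reindex) (auto simp: inj_on_def)
  then have p: "smult ((-1) ^ n) (\<Prod>x\<in>?S. [:- complex_of_real x, 1:]) = ?p"
    using complex_poly_decompose_rsquarefree[OF rsquarefree_continuant[of a n]]
    unfolding roots_continuant by (simp add: degree_continuant)
  have "n = degree ?p" using degree_continuant by simp
  also have "\<dots> = degree (\<Prod>x\<in>?S. [:- complex_of_real x, 1:])"
    by (subst p[symmetric]) simp
  also have "\<dots> = card ?S"
    by (subst degree_prod_sum_eq) auto
  finally show "card ?S = n" by simp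
  show "cmod (poly ?p t) = (\<Prod>x\<in>?S. cmod (t - of_real x))"
    by (subst p[symmetric]) (simp add: poly_prod prod_norm[symmetric] norm_mult norm_power)
qed

section \<open>Orthonormal eigenvectors\<close>

definition eigvec :: "(nat \<Rightarrow> real) \<Rightarrow> nat \<Rightarrow> real \<Rightarrow> nat \<Rightarrow> real" where
  "eigvec a n x i = sol a x i / sqrt (\<Sum>k<n. (sol a x k)\<^sup>2)"

lemma orthonormal_eigvec:
  assumes "x \<in> spectrum a n" "y \<in> spectrum a n"
  shows "(\<Sum>i<n. eigvec a n x i * eigvec a n y i) = (if x = y then 1 else 0)"
proof -
  let ?N = "\<lambda>x. \<Sum>k<n. (sol a x k)\<^sup>2"
  have n: "n > 0" using assms(1) by (cases n) (auto simp: spectrum_def)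
  have pos: "?N x > 0" for x
    using member_le_sum[of 0 "{..<n}" "\<lambda>k. (sol a x k)\<^sup>2"] n by simp
  have "(\<Sum>i<n. eigvec a n x i * eigvec a n y i)
      = (\<Sum>i<n. sol a x i * sol a y i) / (sqrt (?N x) * sqrt (?N y))"
    by (simp add: eigvec_def sum_divide_distrib)
  moreover have "(\<Sum>i<n. sol a x i * sol a y i) = 0" if "x \<noteq> y"
    using christoffel_darboux[of y x a n] assms that by (simp add: spectrum_def)
  moreover have "(\<Sum>i<n. sol a x i * sol a x i) = ?N x" by (simp add: power2_eq_square)
  moreover have "?N x / (sqrt (?N x) * sqrt (?N x)) = 1" using pos[of x] by simp
  ultimately show ?thesis by (cases "x = y") simp_all
qed

lemma sum_mult_delta:
  fixes g :: "'b \<Rightarrow> real"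
  assumes "finite S" "x \<in> S"
  shows "(\<Sum>y\<in>S. g y * (if x = y then 1 else 0)) = g x"
proof -
  have "(\<Sum>y\<in>S. g y * (if x = y then 1 else 0)) = (\<Sum>y\<in>S. if y = x then g x else 0)"
    by (intro sum.cong) auto
  then show ?thesis using assms by simp
qed

lemma sum_swap3:
  "(\<Sum>i\<in>A. \<Sum>x\<in>B. \<Sum>y\<in>C. f i x y) = (\<Sum>x\<in>B. \<Sum>y\<in>C. \<Sum>i\<in>A. f i x y)"
proof -
  have "(\<Sum>i\<in>A. \<Sum>x\<in>B. \<Sum>y\<in>C. f i x y) = (\<Sum>x\<in>B. \<Sum>i\<in>A. \<Sum>y\<in>C. f i x y)"
    by (rule sum.swap)
  also have "\<dots> = (\<Sum>x\<in>B. \<Sum>y\<in>C. \<Sum>i\<in>A. f i x y)"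
    by (rule sum.cong[OF refl]) (rule sum.swap)
  finally show ?thesis .
qed

text \<open>By Bessel's inequality each coordinate vector \<open>\<delta>\<^sub>k\<close> satisfies \<open>\<Sum>\<^sub>x (e x k)\<^sup>2 \<le> 1\<close>, and summing over \<open>k\<close>
  yields \<open>n = n\<close> for an orthonormal family of \<open>n\<close> vectors. Hence equality holds
  for every \<open>k\<close>: the part of \<open>\<delta>\<^sub>k\<close> orthogonal to the family is zero.\<close>

lemma orthonormal_rows_imp_columns:
  fixes e :: "'b \<Rightarrow> nat \<Rightarrow> real"
  assumes fin: "finite S" and card: "card S = n"
    and on: "\<And>x y. x \<in> S \<Longrightarrow> y \<in> S \<Longrightarrow> (\<Sum>i<n. e x i * e y i) = (if x = y then 1 else 0)"
    and k: "k < n" "i < n"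
  shows "(\<Sum>x\<in>S. e x k * e x i) = (if i = k then 1 else 0)"
proof -
  let ?d = "\<lambda>k i. (if i = k then 1 else 0::real) - (\<Sum>x\<in>S. e x k * e x i)"
  \<comment> \<open>The squared norm of the part of \<open>\<delta>\<^sub>k\<close> that is orthogonal to the family.\<close>
  have R: "(\<Sum>i<n. (?d k i)\<^sup>2) = 1 - (\<Sum>x\<in>S. (e x k)\<^sup>2)" if k: "k < n" for k
  proof -
    define c where "c i = (\<Sum>x\<in>S. e x k * e x i)" for i
    have ck: "(\<Sum>x\<in>S. (e x k)\<^sup>2) = c k" by (simp only: c_def power2_eq_square)
    have "(\<Sum>i<n. (?d k i)\<^sup>2) = (\<Sum>i<n. ((if i = k then 1 else 0) - 2 * (if i = k then c k else 0)) + (c i)\<^sup>2)"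
      unfolding c_def[symmetric] by (intro sum.cong refl) (auto simp: power2_diff)
    also have "\<dots> = 1 - 2 * c k + (\<Sum>i<n. (c i)\<^sup>2)"
      unfolding sum.distrib sum_subtractf sum_distrib_left[symmetric] using k by simp
    also have "\<dots> = 1 - 2 * (\<Sum>x\<in>S. (e x k)\<^sup>2) + (\<Sum>i<n. (\<Sum>x\<in>S. e x k * e x i)\<^sup>2)"
      unfolding ck c_def ..
    also have "(\<Sum>i<n. (\<Sum>x\<in>S. e x k * e x i)\<^sup>2)
        = (\<Sum>i<n. \<Sum>x\<in>S. \<Sum>y\<in>S. e x k * e y k * (e x i * e y i))"
      unfolding power2_eq_square sum_product by (intro sum.cong refl) (simp only: mult_ac)
    also have "\<dots> = (\<Sum>x\<in>S. \<Sum>y\<in>S. \<Sum>i<n. e x k * e y k * (e x i * e y i))"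
      by (rule sum_swap3)
    also have "\<dots> = (\<Sum>x\<in>S. \<Sum>y\<in>S. e x k * e y k * (if x = y then 1 else 0))"
      by (intro sum.cong refl) (simp add: sum_distrib_left[symmetric] on)
    also have "\<dots> = (\<Sum>x\<in>S. (e x k)\<^sup>2)"
      using fin by (intro sum.cong refl) (simp only: sum_mult_delta power2_eq_square)
    finally show ?thesis by simp
  qed
  have "(\<Sum>k<n. \<Sum>x\<in>S. (e x k)\<^sup>2) = (\<Sum>x\<in>S. \<Sum>k<n. e x k * e x k)"
    by (subst sum.swap) (simp add: power2_eq_square)
  also have "\<dots> = real n" using on card by simp
  finally have "(\<Sum>k<n. \<Sum>i<n. (?d k i)\<^sup>2) = 0"
    by (simp add: R sum_subtractf)
  moreover have "(?d k i)\<^sup>2 \<le> (\<Sum>i<n. (?d k i)\<^sup>2)"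
    by (rule member_le_sum) (use k in auto)
  moreover have "(\<Sum>i<n. (?d k i)\<^sup>2) \<le> (\<Sum>k<n. \<Sum>i<n. (?d k i)\<^sup>2)"
    by (rule member_le_sum) (use k in \<open>auto intro: sum_nonneg\<close>)
  ultimately have "(?d k i)\<^sup>2 \<le> 0" by linarith
  then show ?thesis by simp
qed

lemma parseval_eigvec:
  "(\<Sum>x\<in>spectrum a n. (\<Sum>i<n. f i * eigvec a n x i)\<^sup>2) = (\<Sum>i<n. (f i)\<^sup>2)"
proof -
  let ?S = "spectrum a n" and ?e = "eigvec a n"
  have "(\<Sum>x\<in>?S. (\<Sum>i<n. f i * ?e x i)\<^sup>2)
      = (\<Sum>x\<in>?S. \<Sum>i<n. \<Sum>j<n. f i * f j * (?e x i * ?e x j))"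
    unfolding power2_eq_square sum_product by (intro sum.cong refl) (simp only: mult_ac)
  also have "\<dots> = (\<Sum>i<n. \<Sum>j<n. \<Sum>x\<in>?S. f i * f j * (?e x i * ?e x j))"
    by (rule sum_swap3)
  also have "\<dots> = (\<Sum>i<n. \<Sum>j<n. f i * f j * (if i = j then 1 else 0))"
    by (intro sum.cong refl)
      (simp add: eq_commute sum_distrib_left[symmetric] orthonormal_rows_imp_columns[OF finite_spectrum card_spectrum orthonormal_eigvec])
  also have "\<dots> = (\<Sum>i<n. (f i)\<^sup>2)"
    by (intro sum.cong refl) (simp only: sum_mult_delta power2_eq_square finite_lessThan)
  finally show ?thesis .
qed

section \<open>Counting eigenvalues through approximate eigenvectors\<close>

text \<open>The Jacobi operator on the half-line. On vectors supported in \<open>{..<n}\<close> its first \<open>n\<close>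
  coordinates are those of the truncated matrix.\<close>

definition jacobi_op :: "(nat \<Rightarrow> real) \<Rightarrow> (nat \<Rightarrow> real) \<Rightarrow> nat \<Rightarrow> real" where
  "jacobi_op a f i = a i * f i - f (Suc i) - (if i = 0 then 0 else f (i - 1))"

text \<open>Summation by parts; the boundary terms disappear for an eigenvector and a test vector that both
  vanish at \<open>Suc m\<close>.\<close>

lemma jacobi_op_symmetric:
  "(\<Sum>i<Suc m. jacobi_op a f i * sol a x i) - x * (\<Sum>i<Suc m. f i * sol a x i)
     = f m * sol a x (Suc m) - f (Suc m) * sol a x m"
proof (induction m)
  case (Suc m)
  then show ?case by (simp add: jacobi_op_def algebra_simps)
qed (simp add: jacobi_op_def algebra_simps)

lemma jacobi_op_eigvec:
  assumes "x \<in> spectrum a n" "f n = 0"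
  shows "(\<Sum>i<n. jacobi_op a f i * eigvec a n x i) = x * (\<Sum>i<n. f i * eigvec a n x i)"
proof -
  obtain m where n: "n = Suc m" using assms(1) by (cases n) (auto simp: spectrum_def)
  have "(\<Sum>i<n. jacobi_op a f i * sol a x i) = x * (\<Sum>i<n. f i * sol a x i)"
    using jacobi_op_symmetric[of a f x m] assms unfolding n spectrum_def by simp
  then show ?thesis unfolding eigvec_def times_divide_eq_right sum_divide_distrib[symmetric]
    by simp
qed

text \<open>Each approximate eigenvector \<open>u j\<close> has spectral measure \<open>\<Sum>\<^sub>x (c j x)\<^sup>2 \<delta>\<^sub>x\<close> over the eigenvalues, whose
  second moment about \<open>E\<close> is the squared error. Chebyshev's inequality, in
  the form \<open>G x \<ge> (1 - (x - E)\<^sup>2 / \<delta>\<^sup>2) / 2\<close>, bounds its integral of \<open>G\<close> from below. Vectors with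
  disjoint supports are orthogonal, so by Bessel's inequality these measures together give
  each eigenvalue a mass of at most \<open>2\<close>, and their contributions may be added.\<close>

lemma spectral_mass_lower_bound:
  fixes u :: "nat \<Rightarrow> nat \<Rightarrow> real" and supp :: "nat \<Rightarrow> nat set"
  assumes I: "finite I"
    and supp: "\<And>j. j \<in> I \<Longrightarrow> supp j \<subseteq> {..<n}" "\<And>j i. j \<in> I \<Longrightarrow> i \<notin> supp j \<Longrightarrow> u j i = 0"
    and disj: "disjoint_family_on supp I"
    and norm: "\<And>j. j \<in> I \<Longrightarrow> 1 \<le> (\<Sum>i<n. (u j i)\<^sup>2)" "\<And>j. j \<in> I \<Longrightarrow> (\<Sum>i<n. (u j i)\<^sup>2) \<le> 2"
    and err: "\<And>j. j \<in> I \<Longrightarrow> (\<Sum>i<n. (jacobi_op a (u j) i - E * u j i)\<^sup>2) \<le> \<delta>\<^sup>2 / 2"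
    and d: "\<delta> > 0" and G0: "\<And>x. G x \<ge> 0" and G: "\<And>x. \<bar>x - E\<bar> \<le> \<delta> \<Longrightarrow> G x \<ge> 1 / 2"
  shows "(\<Sum>x\<in>spectrum a n. G x) \<ge> real (card I) / 8"
proof -
  let ?S = "spectrum a n" and ?e = "eigvec a n"
  define c where "c j x = (\<Sum>i<n. u j i * ?e x i)" for j x
  have c_le: "(\<Sum>j\<in>I. (c j x)\<^sup>2) \<le> 2" if x: "x \<in> ?S" for x
  proof -
    have "(c j x)\<^sup>2 \<le> 2 * (\<Sum>i\<in>supp j. (?e x i)\<^sup>2)" if j: "j \<in> I" for j
    proof -
      have r: "(\<Sum>i<n. u j i * g i) = (\<Sum>i\<in>supp j. u j i * g i)" for g
        using supp j by (intro sum.mono_neutral_right) auto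
      have "(c j x)\<^sup>2 \<le> (\<Sum>i\<in>supp j. (u j i)\<^sup>2) * (\<Sum>i\<in>supp j. (?e x i)\<^sup>2)"
        unfolding c_def r by (rule Cauchy_Schwarz_ineq_sum)
      also have "\<dots> \<le> 2 * (\<Sum>i\<in>supp j. (?e x i)\<^sup>2)"
        using r[of "u j"] norm(2)[OF j] by (intro mult_right_mono sum_nonneg) (auto simp: power2_eq_square)
      finally show ?thesis .
    qed
    then have "(\<Sum>j\<in>I. (c j x)\<^sup>2) \<le> 2 * (\<Sum>j\<in>I. \<Sum>i\<in>supp j. (?e x i)\<^sup>2)"
      by (simp add: sum_distrib_left sum_mono)
    also have "(\<Sum>j\<in>I. \<Sum>i\<in>supp j. (?e x i)\<^sup>2) = (\<Sum>i\<in>(\<Union>j\<in>I. supp j). (?e x i)\<^sup>2)"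
      using I supp(1) disj
      by (intro sum.UNION_disjoint[symmetric]) (auto simp: disjoint_family_on_def intro: finite_subset)
    also have "\<dots> \<le> (\<Sum>i<n. (?e x i)\<^sup>2)"
      using supp(1) by (intro sum_mono2) auto
    also have "\<dots> = 1" using orthonormal_eigvec[OF x x] by (simp add: power2_eq_square)
    finally show ?thesis by simp
  qed
  have G': "G x \<ge> (1 - (x - E)\<^sup>2 / \<delta>\<^sup>2) / 2" for x
  proof -
    define r where "r = (x - E)\<^sup>2 / \<delta>\<^sup>2"
    have "r \<ge> 0" by (simp add: r_def)
    moreover have "r \<ge> 1" if "\<not> \<bar>x - E\<bar> \<le> \<delta>"
    proof -
      have "\<delta>\<^sup>2 \<le> \<bar>x - E\<bar>\<^sup>2" using d that by (intro power_mono) auto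
      then show ?thesis using d unfolding r_def power2_abs by (simp only: le_divide_eq_1_pos zero_less_power)
    qed
    ultimately have "(1 - r) / 2 \<le> G x" using G[of x] G0[of x] by fastforce
    then show ?thesis by (simp only: r_def)
  qed
  have u0: "u j n = 0" if "j \<in> I" for j using supp[OF that] by auto
  have cE: "(\<Sum>x\<in>?S. (x - E)\<^sup>2 * (c j x)\<^sup>2) \<le> \<delta>\<^sup>2 / 2" if j: "j \<in> I" for j
  proof -
    have "(x - E) * c j x = (\<Sum>i<n. (jacobi_op a (u j) i - E * u j i) * ?e x i)" if "x \<in> ?S" for x
      using jacobi_op_eigvec[of x a n "u j", OF that u0[OF j]]
      unfolding c_def by (simp add: left_diff_distrib sum_subtractf mult.assoc sum_distrib_left)
    then have "(\<Sum>x\<in>?S. (x - E)\<^sup>2 * (c j x)\<^sup>2)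
        = (\<Sum>x\<in>?S. (\<Sum>i<n. (jacobi_op a (u j) i - E * u j i) * ?e x i)\<^sup>2)"
      by (intro sum.cong refl) (simp add: power_mult_distrib[symmetric])
    also have "\<dots> \<le> \<delta>\<^sup>2 / 2" unfolding parseval_eigvec using err[OF j] .
    finally show ?thesis .
  qed
  have "real (card I) / 4 \<le> (\<Sum>j\<in>I. \<Sum>x\<in>?S. (1 - (x - E)\<^sup>2 / \<delta>\<^sup>2) / 2 * (c j x)\<^sup>2)"
  proof -
    have "1 / 4 \<le> (\<Sum>x\<in>?S. (1 - (x - E)\<^sup>2 / \<delta>\<^sup>2) / 2 * (c j x)\<^sup>2)" if j: "j \<in> I" for j
    proof -
      have "(\<Sum>x\<in>?S. (1 - (x - E)\<^sup>2 / \<delta>\<^sup>2) / 2 * (c j x)\<^sup>2)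
          = ((\<Sum>x\<in>?S. (c j x)\<^sup>2) - (\<Sum>x\<in>?S. (x - E)\<^sup>2 * (c j x)\<^sup>2) / \<delta>\<^sup>2) / 2"
        unfolding sum_divide_distrib sum_subtractf[symmetric]
        by (intro sum.cong refl) (simp add: left_diff_distrib)
      moreover have "(\<Sum>x\<in>?S. (c j x)\<^sup>2) \<ge> 1" unfolding c_def parseval_eigvec by (rule norm(1)[OF j])
      moreover have "(\<Sum>x\<in>?S. (x - E)\<^sup>2 * (c j x)\<^sup>2) / \<delta>\<^sup>2 \<le> 1 / 2"
        using cE[OF j] d by (simp add: field_simps)
      ultimately show ?thesis by simp
    qed
    then have "(\<Sum>j\<in>I. 1 / 4) \<le> (\<Sum>j\<in>I. \<Sum>x\<in>?S. (1 - (x - E)\<^sup>2 / \<delta>\<^sup>2) / 2 * (c j x)\<^sup>2)"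
      by (rule sum_mono)
    then show ?thesis by simp
  qed
  also have "\<dots> \<le> (\<Sum>j\<in>I. \<Sum>x\<in>?S. G x * (c j x)\<^sup>2)"
    by (intro sum_mono mult_right_mono G') simp
  also have "\<dots> = (\<Sum>x\<in>?S. G x * (\<Sum>j\<in>I. (c j x)\<^sup>2))"
    by (subst sum.swap) (simp add: sum_distrib_left)
  also have "\<dots> \<le> (\<Sum>x\<in>?S. G x * 2)"
    by (intro sum_mono mult_left_mono c_le G0)
  also have "\<dots> = 2 * (\<Sum>x\<in>?S. G x)" by (simp add: sum_distrib_left mult.commute)
  finally show ?thesis by simp
qed

section \<open>An approximate identity made of logarithmic potentials\<close>

text \<open>The difference of the potentials \<open>ln |t - s|\<close> at \<open>t = x + 2iy\<close> and \<open>t = x + iy\<close>, as a function of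
  \<open>x - s\<close>. It equals the integral of the Poisson kernel (times \<open>\<pi>\<close>) over heights from \<open>y\<close> to \<open>2y\<close>, hence it is
  nonnegative with integral \<open>\<pi> y\<close>; after division by \<open>\<pi> y\<close> it is an approximate identity as \<open>y\<close>
  tends to \<open>0\<close>. Unlike the Poisson kernel itself it needs no derivative of the potential.\<close>

definition log_kernel :: "real \<Rightarrow> real \<Rightarrow> real" where
  "log_kernel y x = ln ((x\<^sup>2 + 4 * y\<^sup>2) / (x\<^sup>2 + y\<^sup>2)) / 2"

text \<open>The odd antiderivative of \<open>log_kernel 1\<close>, divided by \<open>\<pi>\<close>.\<close>

definition smooth_step :: "real \<Rightarrow> real" where
  "smooth_step u = (u * ln ((u\<^sup>2 + 4) / (u\<^sup>2 + 1)) + 4 * arctan (u / 2) - 2 * arctan u) / (2 * pi)"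

lemma log_kernel_pos_args:
  assumes "y > (0::real)"
  shows "x\<^sup>2 + y\<^sup>2 > 0" "x\<^sup>2 + 4 * y\<^sup>2 > 0"
  using assms by (auto intro!: add_nonneg_pos)

lemma log_kernel_bounds:
  assumes y: "y > 0"
  shows "0 \<le> log_kernel y x" "log_kernel y x \<le> ln 2"
proof -
  note pos = log_kernel_pos_args[OF y, of x]
  have 1: "(x\<^sup>2 + 4 * y\<^sup>2) / (x\<^sup>2 + y\<^sup>2) \<ge> 1" using pos by simp
  then show "0 \<le> log_kernel y x" by (simp add: log_kernel_def)
  have "(x\<^sup>2 + 4 * y\<^sup>2) / (x\<^sup>2 + y\<^sup>2) \<le> 2 ^ 2" using pos by (simp add: divide_simps)
  then have "ln ((x\<^sup>2 + 4 * y\<^sup>2) / (x\<^sup>2 + y\<^sup>2)) \<le> ln (2 ^ 2)" using 1 by simp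
  also have "ln (2 ^ 2) = 2 * ln (2::real)" by (subst ln_realpow) auto
  finally show "log_kernel y x \<le> ln 2" by (simp add: log_kernel_def)
qed

lemma log_kernel_eq:
  assumes "y > 0"
  shows "log_kernel y (x - s) = ln (cmod (Complex x (2 * y) - of_real s)) - ln (cmod (Complex x y - of_real s))"
proof -
  note pos = log_kernel_pos_args[OF assms, of "x - s"]
  have "cmod (Complex x (2 * y) - of_real s) = sqrt ((x - s)\<^sup>2 + 4 * y\<^sup>2)"
       "cmod (Complex x y - of_real s) = sqrt ((x - s)\<^sup>2 + y\<^sup>2)"
    by (auto simp: cmod_def power_mult_distrib)
  then show ?thesis using pos
    by (simp add: log_kernel_def ln_div ln_sqrt field_simps)
qed

lemma measurable_log_kernel [measurable]: "log_kernel y \<in> borel_measurable borel"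
  unfolding log_kernel_def by measurable

lemma smooth_step_deriv:
  assumes y: "y > 0"
  shows "((\<lambda>x. pi * y * smooth_step ((x - s) / y)) has_real_derivative log_kernel y (x - s)) (at x)"
proof -
  let ?u = "(x - s) / y"
  have pos: "?u\<^sup>2 + 1 > 0" "?u\<^sup>2 + 4 > 0" by (auto intro!: add_nonneg_pos)
  have D: "(smooth_step has_real_derivative ln ((u\<^sup>2 + 4) / (u\<^sup>2 + 1)) / (2 * pi)) (at u)" for u
  proof -
    have pos: "u\<^sup>2 + 1 > 0" "u\<^sup>2 + 4 > 0" by (auto intro!: add_nonneg_pos)
    have e: "ln ((u\<^sup>2 + 4) / (u\<^sup>2 + 1)) = ln (u\<^sup>2 + 4) - ln (u\<^sup>2 + 1)" for u :: real
      by (intro ln_divide_pos add_nonneg_pos) auto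
    have "((\<lambda>u. (u * (ln (u\<^sup>2 + 4) - ln (u\<^sup>2 + 1)) + 4 * arctan (u / 2) - 2 * arctan u) / (2 * pi))
       has_real_derivative (ln (u\<^sup>2 + 4) - ln (u\<^sup>2 + 1) + u * (2 * u / (u\<^sup>2 + 4) - 2 * u / (u\<^sup>2 + 1))
          + 4 * (1 / 2 / (1 + (u / 2)\<^sup>2)) - 2 * (1 / (1 + u\<^sup>2))) / (2 * pi)) (at u)"
      using pos by (auto intro!: derivative_eq_intros) (simp add: divide_simps, simp add: algebra_simps)
    moreover have "u * (2 * u / (u\<^sup>2 + 4) - 2 * u / (u\<^sup>2 + 1)) + 4 * (1 / 2 / (1 + (u / 2)\<^sup>2)) - 2 * (1 / (1 + u\<^sup>2)) = 0"
    proof -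
      have "4 * (1 / 2 / (1 + (u / 2)\<^sup>2)) = 8 / (u\<^sup>2 + 4)"
        using pos by (simp add: divide_simps power2_eq_square) (simp add: algebra_simps)?
      moreover have "u * (2 * u / (u\<^sup>2 + 4)) = 2 - 8 / (u\<^sup>2 + 4)"
        using pos by (simp add: divide_simps) (simp add: algebra_simps power2_eq_square)
      moreover have "u * (2 * u / (u\<^sup>2 + 1)) = 2 - 2 / (u\<^sup>2 + 1)"
        using pos by (simp add: divide_simps) (simp add: algebra_simps power2_eq_square)
      ultimately show ?thesis by (simp add: right_diff_distrib add.commute)
    qed
    ultimately show ?thesis unfolding smooth_step_def e by (simp add: add.assoc)
  qed
  have "((\<lambda>x. pi * y * smooth_step ((x - s) / y)) has_real_derivative
      pi * y * (ln ((?u\<^sup>2 + 4) / (?u\<^sup>2 + 1)) / (2 * pi) * (1 / y))) (at x)"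
    by (auto intro!: derivative_eq_intros DERIV_chain2[OF D])
  moreover have "(?u\<^sup>2 + 4) / (?u\<^sup>2 + 1) = ((x - s)\<^sup>2 + 4 * y\<^sup>2) / ((x - s)\<^sup>2 + y\<^sup>2)"
    using y pos log_kernel_pos_args[OF y, of "x - s"]
    by (simp add: power_divide divide_simps)
  ultimately show ?thesis using y by (simp add: log_kernel_def)
qed

lemma smooth_step_minus: "smooth_step (- u) = - smooth_step u"
  by (simp add: smooth_step_def diff_divide_distrib add_divide_distrib arctan_minus)

lemma smooth_step_at_top: "(smooth_step \<longlongrightarrow> 1 / 2) at_top"
  unfolding smooth_step_def by real_asymp

lemma smooth_step_mono: "u \<le> w \<Longrightarrow> smooth_step u \<le> smooth_step w"
proof -
  assume "u \<le> w"
  then have "pi * 1 * smooth_step ((u - 0) / 1) \<le> pi * 1 * smooth_step ((w - 0) / 1)"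
    by (rule DERIV_nonneg_imp_nondecreasing) (use smooth_step_deriv[of 1 0] log_kernel_bounds(1)[of 1] in auto)
  then show ?thesis by simp
qed

lemma smooth_step_le_half: "smooth_step u \<le> 1 / 2"
  by (rule tendsto_lowerbound[OF smooth_step_at_top])
    (auto simp: eventually_at_top_linorder intro!: exI[of _ u] smooth_step_mono)

lemma smooth_step_abs_le: "\<bar>smooth_step u\<bar> \<le> 1 / 2"
  using smooth_step_le_half[of u] smooth_step_le_half[of "- u"] by (simp add: smooth_step_minus)

text \<open>The convolution of the indicator function of \<open>[\<alpha>, \<beta>]\<close> with the normalised kernel, in terms of its antiderivative.\<close>

definition smooth_indicator :: "real \<Rightarrow> real \<Rightarrow> real \<Rightarrow> real \<Rightarrow> real" where
  "smooth_indicator y \<alpha> \<beta> s = smooth_step ((\<beta> - s) / y) - smooth_step ((\<alpha> - s) / y)"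

lemma smooth_indicator_integral:
  assumes "y > 0" "\<alpha> \<le> \<beta>"
  shows "(\<integral>\<^sup>+x. ennreal (log_kernel y (x - s)) * indicator {\<alpha>..\<beta>} x \<partial>lborel) = ennreal (pi * y * smooth_indicator y \<alpha> \<beta> s)"
proof -
  have "(\<integral>\<^sup>+x. ennreal (log_kernel y (x - s)) * indicator {\<alpha>..\<beta>} x \<partial>lborel)
     = ennreal (pi * y * smooth_step ((\<beta> - s) / y) - pi * y * smooth_step ((\<alpha> - s) / y))"
    using assms log_kernel_bounds
    by (intro nn_integral_FTC_Icc smooth_step_deriv) (auto intro: DERIV_subset smooth_step_deriv)
  then show ?thesis by (simp add: smooth_indicator_def right_diff_distrib)
qed

lemma smooth_indicator_nonneg: "y > 0 \<Longrightarrow> \<alpha> \<le> \<beta> \<Longrightarrow> 0 \<le> smooth_indicator y \<alpha> \<beta> s"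
  unfolding smooth_indicator_def by (simp add: smooth_step_mono divide_right_mono)

lemma smooth_indicator_le_1: "smooth_indicator y \<alpha> \<beta> s \<le> 1"
  using smooth_step_abs_le[of "(\<beta> - s) / y"] smooth_step_abs_le[of "(\<alpha> - s) / y"]
  unfolding smooth_indicator_def by linarith

text \<open>The quantitative form of the convergence to the indicator function, with room between an inner window of
  half-width \<open>\<delta>\<close> and an outer one of half-width \<open>h\<close>.\<close>

lemma smooth_indicator_sharp:
  assumes \<delta>: "0 < \<delta>" "\<delta> < \<rho>" "\<rho> < h" and \<eta>: "\<eta> > 0"
  shows "\<exists>y>0. (\<forall>s. \<bar>s - E\<bar> \<le> \<delta> \<longrightarrow> smooth_indicator y (E - \<rho>) (E + \<rho>) s \<ge> 1 / 2)
     \<and> (\<forall>s. \<bar>s - E\<bar> \<ge> h \<longrightarrow> smooth_indicator y (E - \<rho>) (E + \<rho>) s \<le> \<eta>)"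
proof -
  have "eventually (\<lambda>u. smooth_step u > 1 / 2 - min \<eta> (1 / 4)) at_top"
    using \<eta> by (intro order_tendstoD(1)[OF smooth_step_at_top]) auto
  then obtain U0 where U0: "\<And>u. u \<ge> U0 \<Longrightarrow> smooth_step u > 1 / 2 - min \<eta> (1 / 4)"
    by (auto simp: eventually_at_top_linorder)
  define U where "U = max U0 1"
  define y where "y = min (\<rho> - \<delta>) (h - \<rho>) / U"
  have U: "U > 0" "U \<ge> U0" by (auto simp: U_def)
  have y: "y > 0" using U \<delta> by (simp add: y_def)
  have big: "smooth_step (r / y) > 1 / 2 - min \<eta> (1 / 4)" if "r \<ge> y * U" for r
  proof (rule U0)
    have "U \<le> r / y" using that y by (simp add: pos_le_divide_eq mult.commute)
    then show "U0 \<le> r / y" using U(2) by linarith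
  qed
  have yU: "y * U = min (\<rho> - \<delta>) (h - \<rho>)" using U by (simp add: y_def)
  show ?thesis
  proof (intro exI[of _ y] conjI allI impI y)
    fix s assume s: "\<bar>s - E\<bar> \<le> \<delta>"
    have "smooth_step ((E + \<rho> - s) / y) > 1 / 2 - min \<eta> (1 / 4)"
      by (rule big) (use s yU in linarith)
    moreover have "smooth_step ((s - (E - \<rho>)) / y) > 1 / 2 - min \<eta> (1 / 4)"
      by (rule big) (use s yU in linarith)
    moreover have "smooth_step ((E - \<rho> - s) / y) = - smooth_step ((s - (E - \<rho>)) / y)"
      unfolding smooth_step_minus[symmetric] by (simp add: minus_divide_left)
    ultimately show "smooth_indicator y (E - \<rho>) (E + \<rho>) s \<ge> 1 / 2"
      unfolding smooth_indicator_def by linarith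
  next
    fix s assume s: "\<bar>s - E\<bar> \<ge> h"
    have m: "smooth_step (- r / y) = - smooth_step (r / y)" for r
      unfolding smooth_step_minus[symmetric] by simp
    show "smooth_indicator y (E - \<rho>) (E + \<rho>) s \<le> \<eta>"
    proof (cases "s \<ge> E")
      case True
      have "smooth_step ((s - (E + \<rho>)) / y) > 1 / 2 - min \<eta> (1 / 4)"
        by (rule big) (use s True yU in linarith)
      then have "smooth_step ((E + \<rho> - s) / y) < - 1 / 2 + \<eta>"
        using m[of "s - (E + \<rho>)"] by (simp add: algebra_simps)
      then show ?thesis using smooth_step_abs_le[of "(E - \<rho> - s) / y"] unfolding smooth_indicator_def by linarith
    next
      case False
      have "smooth_step ((E - \<rho> - s) / y) > 1 / 2 - min \<eta> (1 / 4)"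
        by (rule big) (use s False yU in linarith)
      then show ?thesis using smooth_step_abs_le[of "(E + \<rho> - s) / y"] unfolding smooth_indicator_def by linarith
    qed
  qed
qed

section \<open>Norms of two by two matrices\<close>

lemma matrix_vector_2:
  fixes g :: "complex^2^2"
  shows "(g *v z) $ 1 = g$1$1 * z$1 + g$1$2 * z$2" "(g *v z) $ 2 = g$2$1 * z$1 + g$2$2 * z$2"
  by (simp_all add: matrix_vector_mult_def sum_2)

lemma matrix_matrix_2:
  fixes g h :: "complex^2^2"
  shows "(g ** h) $ i $ j = g$i$1 * h$1$j + g$i$2 * h$2$j"
  by (simp add: matrix_matrix_mult_def sum_2)

lemma schroedinger_matrix_entries [simp]:
  "schroedinger_matrix z $ 1 $ 1 = z" "schroedinger_matrix z $ 1 $ 2 = -1"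
  "schroedinger_matrix z $ 2 $ 1 = 1" "schroedinger_matrix z $ 2 $ 2 = 0"
  by (simp_all add: schroedinger_matrix_def)

lemma opnorm_le_sum_entries:
  "opnorm g \<le> cmod (g$1$1) + cmod (g$1$2) + cmod (g$2$1) + cmod (g$2$2)"
proof (rule onorm_le)
  fix z :: "complex^2"
  have n: "cmod (z$i) \<le> norm z" for i by (rule Finite_Cartesian_Product.norm_nth_le)
  have "norm (g *v z) \<le> cmod ((g *v z)$1) + cmod ((g *v z)$2)"
    using L2_set_le_sum[of UNIV "\<lambda>i. cmod ((g *v z) $ i)"] by (simp add: norm_vec_def sum_2)
  also have "\<dots> \<le> (cmod (g$1$1) * norm z + cmod (g$1$2) * norm z) + (cmod (g$2$1) * norm z + cmod (g$2$2) * norm z)"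
    unfolding matrix_vector_2
    by (intro add_mono order_trans[OF norm_triangle_ineq]) (auto simp: norm_mult intro!: mult_left_mono n)
  finally show "norm (g *v z) \<le> (cmod (g$1$1) + cmod (g$1$2) + cmod (g$2$1) + cmod (g$2$2)) * norm z"
    by (simp add: algebra_simps)
qed

lemma norm_column_le_opnorm:
  fixes g :: "complex^2^2"
  shows "sqrt ((cmod (g$1$j))\<^sup>2 + (cmod (g$2$j))\<^sup>2) \<le> opnorm g"
proof -
  have "norm (g *v axis j 1) \<le> opnorm g * norm (axis j (1::complex))"
    by (rule onorm) simp
  moreover have "g *v axis j 1 = column j g"
    using exhaust_2[of j] by (auto simp: vec_eq_iff forall_2 matrix_vector_2 column_def axis_def)
  ultimately show ?thesis
    using exhaust_2[of j] by (auto simp: norm_vec_def L2_set_def sum_2 column_def axis_def)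
qed

lemma norm_entry_le_opnorm: "cmod (g$1$1) \<le> opnorm g"
  by (rule order_trans[OF _ norm_column_le_opnorm[of g 1]]) (simp add: real_le_rsqrt)

lemma opnorm_mult: "opnorm (g ** h) \<le> opnorm g * opnorm h"
proof -
  have "(*v) (g ** h) = (*v) g \<circ> (*v) h" by (auto simp: matrix_vector_mul_assoc)
  then show ?thesis by (metis onorm_compose matrix_vector_mul_bounded_linear)
qed

text \<open>Hadamard's inequality: the determinant is at most the product of the norms of the two columns.\<close>

lemma cmod_det_le_opnorm:
  fixes g :: "complex^2^2"
  shows "cmod (det g) \<le> (opnorm g)\<^sup>2"
proof -
  have "cmod (det g) \<le> cmod (g$1$1) * cmod (g$2$2) + cmod (g$2$1) * cmod (g$1$2)"
    unfolding det_2 by (rule order_trans[OF norm_triangle_ineq4]) (simp add: norm_mult mult.commute)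
  also have "\<dots> \<le> sqrt ((cmod (g$1$1))\<^sup>2 + (cmod (g$2$1))\<^sup>2) * sqrt ((cmod (g$1$2))\<^sup>2 + (cmod (g$2$2))\<^sup>2)"
  proof -
    have "(a * d + c * b)\<^sup>2 \<le> (a\<^sup>2 + c\<^sup>2) * (b\<^sup>2 + d\<^sup>2)" for a b c d :: real
      using sum_squares_ge_zero[of "a * b - c * d" 0] by (simp add: power2_eq_square algebra_simps)
    then show ?thesis by (auto simp: real_sqrt_mult[symmetric] intro!: real_le_rsqrt)
  qed
  also have "\<dots> \<le> opnorm g * opnorm g"
    by (intro mult_mono norm_column_le_opnorm) (auto simp: onorm_pos_le)
  finally show ?thesis by (simp add: power2_eq_square)
qed

lemma opnorm_ge_1: "det g = 1 \<Longrightarrow> opnorm g \<ge> 1"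
  using cmod_det_le_opnorm[of g] onorm_pos_le[of "(*v) g"]
  by (simp add: power2_ge_1_iff)

lemma measurable_opnorm [measurable]: "opnorm \<in> borel_measurable borel"
proof -
  have lip: "opnorm g \<le> opnorm h + 4 * norm (g - h)" for g h
  proof -
    have "opnorm g = onorm (\<lambda>z. h *v z + (g - h) *v z)"
      by (simp add: matrix_vector_mult_diff_rdistrib)
    also have "\<dots> \<le> opnorm h + opnorm (g - h)"
      by (rule onorm_triangle) auto
    also have "opnorm (g - h) \<le> 4 * norm (g - h)"
    proof -
      have "cmod ((g - h)$i$j) \<le> norm (g - h)" for i j
        by (meson Finite_Cartesian_Product.norm_nth_le order_trans)
      from this[of 1 1] this[of 1 2] this[of 2 1] this[of 2 2] opnorm_le_sum_entries[of "g - h"]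
      show ?thesis by linarith
    qed
    finally show ?thesis by simp
  qed
  have "4-lipschitz_on UNIV opnorm"
  proof (rule lipschitz_onI)
    fix g h
    show "dist (opnorm g) (opnorm h) \<le> 4 * dist g h"
      using lip[of g h] lip[of h g] by (simp add: dist_norm norm_minus_commute abs_le_iff)
  qed simp
  then show ?thesis
    by (intro borel_measurable_continuous_onI lipschitz_on_continuous_on)
qed

lemma measurable_matrix_mult:
  "(\<lambda>(g, h). (g::complex^2^2) ** (h::complex^2^2)) \<in> measurable (borel \<Otimes>\<^sub>M borel) borel"
proof -
  have "continuous_on UNIV (\<lambda>(g, h). (g::complex^2^2) ** (h::complex^2^2))"
    unfolding matrix_matrix_mult_def case_prod_beta
    by (intro continuous_intros)
  then show ?thesis unfolding borel_prod by (rule borel_measurable_continuous_onI)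
qed

section \<open>Transfer matrices off the real axis\<close>

text \<open>The head of the list is the leftmost factor and thus the site added last, as in the convolution powers; hence
  the sites of the Jacobi matrix are the entries of the reversed list.\<close>

primrec transfer :: "complex \<Rightarrow> real list \<Rightarrow> complex^2^2" where
  "transfer t [] = mat 1"
| "transfer t (x # xs) = schroedinger_matrix (of_real x - t) ** transfer t xs"

abbreviation sites :: "real list \<Rightarrow> nat \<Rightarrow> real" where
  "sites xs \<equiv> (!) (rev xs)"

lemma det_schroedinger: "det (schroedinger_matrix z) = 1"
  by (simp add: det_2)

lemma det_transfer: "det (transfer t xs) = 1"
  by (induction xs) (simp_all add: det_mul det_schroedinger)

lemma transfer_append: "transfer t (xs @ ys) = transfer t xs ** transfer t ys"
  by (induction xs) (simp_all add: matrix_mul_assoc)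

lemma transfer_first_column:
  "transfer t xs $ 1 $ 1 = poly (continuant (sites xs) (length xs)) t
   \<and> transfer t xs $ 2 $ 1 = poly (prev_continuant (sites xs) (length xs)) t"
proof (induction xs)
  case (Cons x xs)
  define b where "b = sites (x # xs)"
  have "continuant b (length xs) = continuant (sites xs) (length xs)"
    "prev_continuant b (length xs) = prev_continuant (sites xs) (length xs)"
    using continuant_cong[of "length xs" b "sites xs"] by (auto simp: b_def nth_append)
  moreover have "b (length xs) = x" by (simp add: b_def nth_append)
  ultimately show ?case using Cons
    unfolding b_def[symmetric] by (simp add: matrix_matrix_2 continuant_Suc algebra_simps)
qed (simp add: mat_def)

text \<open>The current of the solution with initial vector \<open>(1, \<zeta>)\<close>. The free parameter \<open>\<zeta>\<close> gives access to
  the second column of the transfer matrix.\<close>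

lemma transfer_flux:
  fixes \<zeta> t :: complex and xs :: "real list"
  defines "J \<equiv> \<lambda>xs. Im ((transfer t xs $1$1 + \<zeta> * transfer t xs $1$2) * cnj (transfer t xs $2$1 + \<zeta> * transfer t xs $2$2))"
  shows "J (x # xs) = J xs - Im t * (cmod (transfer t xs $1$1 + \<zeta> * transfer t xs $1$2))\<^sup>2"
    and "J [] = - Im \<zeta>"
  unfolding J_def cmod_power2
  by (simp_all add: matrix_matrix_2 algebra_simps power2_eq_square mat_def)

text \<open>The first step already costs \<open>Im t\<close> because the first coordinate of the initial vector is \<open>1\<close>.\<close>

lemma transfer_flux_le:
  assumes "Im t > 0" "xs \<noteq> []"
  shows "Im ((transfer t xs $1$1 + \<zeta> * transfer t xs $1$2) * cnj (transfer t xs $2$1 + \<zeta> * transfer t xs $2$2))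
    \<le> - Im \<zeta> - Im t"
  using assms(2)
proof (induction xs rule: list_nonempty_induct)
  case (single x)
  then show ?case unfolding transfer_flux(1) transfer_flux(2) by (simp add: mat_def)
next
  case (cons x xs)
  moreover have "0 \<le> Im t * (cmod (transfer t xs $1$1 + \<zeta> * transfer t xs $1$2))\<^sup>2"
    using assms(1) by simp
  ultimately show ?case unfolding transfer_flux(1)[of t x xs] by linarith
qed

text \<open>If \<open>\<zeta>\<close> is chosen such that the first coordinate of the solution starting at \<open>(1, \<zeta>)\<close>
  vanishes, then the current is zero at the end, which by the flux estimate forces
  \<open>Im \<zeta> \<le> - Im t\<close>; but \<open>|\<zeta>|\<close> is the quotient of the two entries.\<close>

lemma cmod_transfer_12_le:
  assumes "Im t > 0"
  shows "Im t * cmod (transfer t xs $1$2) \<le> cmod (transfer t xs $1$1)"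
proof (cases "transfer t xs $1$2 = 0 \<or> xs = []")
  case False
  define \<zeta> where "\<zeta> = - transfer t xs $1$1 / transfer t xs $1$2"
  have "transfer t xs $1$1 + \<zeta> * transfer t xs $1$2 = 0" using False by (simp add: \<zeta>_def)
  then have "Im t \<le> - Im \<zeta>" using transfer_flux_le[OF assms, of xs \<zeta>] False by simp
  also have "\<dots> \<le> cmod \<zeta>" using abs_Im_le_cmod[of \<zeta>] by linarith
  finally show ?thesis using False by (simp add: \<zeta>_def norm_divide field_simps)
qed (auto simp: mat_def)

text \<open>The current of the solution \<open>(1, 0)\<close> is at least \<open>Im t |Q|\<^sup>2\<close> in absolute value, where \<open>Q\<close> is the lower entry, and at most
  the product of the absolute values of the two entries.\<close>

lemma cmod_transfer_21_le:
  assumes "Im t > 0"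
  shows "Im t * cmod (transfer t (x # xs) $2$1) \<le> cmod (transfer t (x # xs) $1$1)"
proof -
  let ?P = "transfer t (x # xs) $1$1" and ?Q = "transfer t xs $1$1"
  have Q: "transfer t (x # xs) $2$1 = ?Q" by (simp add: matrix_matrix_2)
  have "Im (?P * cnj ?Q) \<le> - (Im t * (cmod ?Q)\<^sup>2)"
  proof -
    have "Im (transfer t xs $1$1 * cnj (transfer t xs $2$1)) \<le> 0"
      using transfer_flux_le[OF assms, of xs 0] assms by (cases "xs = []") (auto simp: mat_def)
    then show ?thesis using transfer_flux(1)[of t x xs 0] Q by simp
  qed
  then have "Im t * (cmod ?Q)\<^sup>2 \<le> cmod ?P * cmod ?Q"
    using abs_Im_le_cmod[of "?P * cnj ?Q"] by (simp add: norm_mult)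
  then show ?thesis unfolding Q by (cases "?Q = 0") (auto simp: power2_eq_square)
qed

text \<open>Off the real axis the continuant alone carries the growth of the transfer matrix; this links the Lyapunov
  exponent with the eigenvalues of the Jacobi matrices.\<close>

lemma opnorm_transfer_le:
  assumes t: "Im t > 0"
  shows "opnorm (transfer t xs) \<le> (2 + 2 / Im t + 1 / (Im t)\<^sup>2) * cmod (transfer t xs $1$1)"
proof (cases xs)
  case Nil
  have "opnorm (transfer t xs) \<le> 2"
    using opnorm_le_sum_entries[of "transfer t xs"] Nil by (simp add: mat_def)
  also have "2 \<le> 2 + 2 / Im t + 1 / (Im t)\<^sup>2" using t by simp
  finally show ?thesis using Nil by (simp add: mat_def)
next
  case (Cons x ys)
  let ?A = "transfer t xs" and ?y = "Im t"
  have 12: "cmod (?A$1$2) \<le> cmod (?A$1$1) / ?y"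
    using cmod_transfer_12_le[OF t, of xs] t by (simp add: field_simps)
  have 21: "cmod (?A$2$1) \<le> cmod (?A$1$1) / ?y"
    using cmod_transfer_21_le[OF t, of x ys] t Cons by (simp add: field_simps)
  have "cmod (?A$2$2) \<le> cmod (?A$2$1) / ?y"
    using cmod_transfer_12_le[OF t, of ys] t Cons by (simp add: matrix_matrix_2 field_simps)
  also have "\<dots> \<le> cmod (?A$1$1) / ?y / ?y" using 21 t by (intro divide_right_mono) auto
  finally have 22: "cmod (?A$2$2) \<le> cmod (?A$1$1) / ?y\<^sup>2" by (simp add: power2_eq_square)
  have "opnorm ?A \<le> cmod (?A$1$1) + cmod (?A$1$1) / ?y + cmod (?A$1$1) / ?y + cmod (?A$1$1) / ?y\<^sup>2"
    using opnorm_le_sum_entries[of ?A] 12 21 22 by linarith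
  also have "\<dots> \<le> (2 + 2 / ?y + 1 / ?y\<^sup>2) * cmod (?A$1$1)"
    by (simp add: algebra_simps)
  finally show ?thesis .
qed

section \<open>Random words and the Lyapunov exponent\<close>

text \<open>The product measure is evaluated only through iterated integrals, since the product of the
  discrete \<open>\<sigma>\<close>-algebras of two uncountable types need not be discrete.\<close>

lemma mult_convolution_distr_pmf:
  fixes f :: "'a \<Rightarrow> complex^2^2" and g :: "'b \<Rightarrow> complex^2^2"
  shows "mult_convolution (distr (measure_pmf p) borel f) (distr (measure_pmf q) borel g)
    = distr (measure_pmf (pair_pmf p q)) borel (\<lambda>(x, y). f x ** g y)"
proof -
  let ?M = "distr (measure_pmf p) borel f" and ?N = "distr (measure_pmf q) borel g"
  interpret N: prob_space ?N by (rule measure_pmf.prob_space_distr) simp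
  have m [measurable]: "(\<lambda>(g, h). (g::complex^2^2) ** (h::complex^2^2)) \<in> measurable (?M \<Otimes>\<^sub>M ?N) borel"
    using measurable_matrix_mult
    by (subst measurable_cong_sets[OF sets_pair_measure_cong[of _ borel _ borel] refl]) simp_all
  show ?thesis
  proof (rule measure_eqI)
    fix A assume "A \<in> sets (mult_convolution ?M ?N)"
    then have A [measurable]: "A \<in> sets borel" by (simp add: mult_convolution_def)
    have m2: "(\<lambda>z. indicator A (case z of (g, h) \<Rightarrow> g ** h) :: ennreal) \<in> borel_measurable (?M \<Otimes>\<^sub>M ?N)"
      using measurable_compose[OF m borel_measurable_indicator[OF A]] by simp
    have "emeasure (mult_convolution ?M ?N) A = (\<integral>\<^sup>+z. indicator A z \<partial>mult_convolution ?M ?N)"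
      using A by (simp add: mult_convolution_def)
    also have "\<dots> = (\<integral>\<^sup>+z. indicator A (case z of (g, h) \<Rightarrow> g ** h) \<partial>(?M \<Otimes>\<^sub>M ?N))"
      unfolding mult_convolution_def by (intro nn_integral_distr m) simp
    also have "\<dots> = (\<integral>\<^sup>+x. \<integral>\<^sup>+y. indicator A (x ** y) \<partial>?N \<partial>?M)"
      using N.nn_integral_fst[OF m2] by simp
    also have "\<dots> = (\<integral>\<^sup>+x. \<integral>\<^sup>+y. indicator A (f x ** y) \<partial>?N \<partial>measure_pmf p)"
      using N.borel_measurable_nn_integral_fst[OF m2] by (intro nn_integral_distr) auto
    also have "\<dots> = (\<integral>\<^sup>+x. \<integral>\<^sup>+y. indicator A (f x ** g y) \<partial>measure_pmf q \<partial>measure_pmf p)"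
    proof (intro nn_integral_cong)
      fix x
      have "(\<lambda>h::complex^2^2. case (f x, h) of (g, h) \<Rightarrow> g ** h) \<in> borel_measurable borel"
        by (rule measurable_compose[where f="\<lambda>h. (f x, h)" and g="\<lambda>(g, h). (g::complex^2^2) ** (h::complex^2^2)", OF _ measurable_matrix_mult]) simp
      then have "(\<lambda>h::complex^2^2. f x ** h) \<in> borel_measurable borel" by simp
      then have "(\<lambda>h::complex^2^2. indicator A (f x ** h) :: ennreal) \<in> borel_measurable borel"
        using A by (intro measurable_compose[OF _ borel_measurable_indicator])
      then show "(\<integral>\<^sup>+y. indicator A (f x ** y) \<partial>?N) = (\<integral>\<^sup>+y. indicator A (f x ** g y) \<partial>measure_pmf q)"
        by (intro nn_integral_distr) auto
    qed
    also have "\<dots> = (\<integral>\<^sup>+z. indicator A (case z of (x, y) \<Rightarrow> f x ** g y) \<partial>pair_pmf p q)"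
      by (simp add: nn_integral_pair_pmf')
    also have "\<dots> = (\<integral>\<^sup>+z. indicator A z \<partial>distr (measure_pmf (pair_pmf p q)) borel (\<lambda>(x, y). f x ** g y))"
      by (subst nn_integral_distr) auto
    finally show "emeasure (mult_convolution ?M ?N) A = emeasure (distr (measure_pmf (pair_pmf p q)) borel (\<lambda>(x, y). f x ** g y)) A"
      using A by simp
  qed (simp add: mult_convolution_def)
qed

lemma convolution_power_transfer:
  "convolution_power (distr (measure_pmf D) borel (\<lambda>a. schroedinger_matrix (of_real a - t))) n
     = distr (measure_pmf (replicate_pmf n D)) borel (transfer t)"
proof (induction n)
  case 0
  show ?case by (simp add: return_pmf.rep_eq distr_return)
next
  case (Suc n)
  have "replicate_pmf (Suc n) D = map_pmf (\<lambda>(x, xs). x # xs) (pair_pmf D (replicate_pmf n D))"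
    by (simp add: pair_pmf_def map_bind_pmf map_pmf_def bind_assoc_pmf bind_return_pmf)
  then show ?case
    by (simp add: Suc mult_convolution_distr_pmf map_pmf_rep_eq distr_distr o_def case_prod_unfold)
qed

text \<open>Fekete's subadditive lemma: the limit is the infimum of the quotients, approached by division of
  \<open>n\<close> with remainder by a nearly optimal \<open>m\<close>.\<close>

lemma fekete:
  fixes u :: "nat \<Rightarrow> real"
  assumes nonneg: "\<And>n. u n \<ge> 0" and sub: "\<And>m n. u (m + n) \<le> u m + u n"
  shows "convergent (\<lambda>n. 1 / real n * u n)"
proof -
  \<comment> \<open>The index \<open>0\<close> is excluded since \<open>u 0 / 0 = 0\<close>.\<close>
  define L where "L = (INF n\<in>{1..}. u n / real n)"
  have bdd: "bdd_below ((\<lambda>n. u n / real n) ` {1..})" using nonneg by (intro bdd_belowI2[of _ 0]) auto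
  have mult: "u (q * m + r) \<le> real q * u m + u r" for q m r
  proof (induction q)
    case (Suc q)
    have "u (Suc q * m + r) \<le> u m + u (q * m + r)" using sub[of m "q * m + r"] by (simp add: algebra_simps)
    then show ?case using Suc by (simp add: algebra_simps)
  qed simp
  have "(\<lambda>n. 1 / real n * u n) \<longlonglongrightarrow> L"
  proof (rule LIMSEQ_I)
    fix e :: real assume e: "e > 0"
    have "\<exists>m\<in>{1..}. u m / real m < L + e / 2"
      using cInf_lessD[of "(\<lambda>n. u n / real n) ` {1..}" "L + e / 2"] e unfolding L_def by auto
    then obtain m where m: "m \<ge> 1" "u m / real m < L + e / 2" by auto
    \<comment> \<open>A bound for all remainders modulo \<open>m\<close>.\<close>
    define K where "K = (\<Sum>r<m. u r)"
    have K: "u r \<le> K" if "r < m" for r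
      unfolding K_def using that nonneg by (intro member_le_sum) auto
    obtain N0 where N0: "real N0 > 2 * K / e" using reals_Archimedean2 by blast
    have "norm (1 / real n * u n - L) < e" if n: "n \<ge> max 1 N0" for n
    proof -
      have n0: "real n > 0" using n by simp
      have "L \<le> u n / real n" unfolding L_def using n by (intro cINF_lower bdd) auto
      moreover have "u n / real n < L + e"
      proof -
        have "u n \<le> real (n div m) * u m + u (n mod m)" using mult[of "n div m" m "n mod m"] by simp
        also have "real (n div m) * u m \<le> real n / real m * u m"
          using nonneg by (intro mult_right_mono of_nat_div_le_of_nat) auto
        also have "u (n mod m) \<le> K" using m by (intro K) auto
        finally have "u n / real n \<le> (real n * (u m / real m) + K) / real n"
          using n0 by (intro divide_right_mono) (auto simp: field_simps)
        also have "\<dots> = u m / real m + K / real n" using n0 by (simp add: field_simps)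
        also have "K / real n < e / 2"
        proof -
          have "2 * K / e < real n" using N0 n by linarith
          then show ?thesis using e n0 by (simp add: field_simps)
        qed
        finally show ?thesis using m by linarith
      qed
      ultimately show ?thesis by (simp add: abs_if)
    qed
    then show "\<exists>no. \<forall>n\<ge>no. norm (1 / real n * u n - L) < e" by blast
  qed
  then show ?thesis by (rule convergentI)
qed

lemma ln_opnorm_transfer_nonneg: "ln (opnorm (transfer t xs)) \<ge> 0"
  using opnorm_ge_1[OF det_transfer[of t xs]] by simp

lemma nn_integral_transfer_subadditive:
  fixes D :: "real pmf" and t :: complex
  defines "F \<equiv> \<lambda>n. \<integral>\<^sup>+xs. ennreal (ln (opnorm (transfer t xs))) \<partial>replicate_pmf n D"
  shows "F (m + n) \<le> F m + F n"
proof -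
  have le: "ennreal (ln (opnorm (transfer t (xs @ ys)))) \<le> ennreal (ln (opnorm (transfer t xs))) + ennreal (ln (opnorm (transfer t ys)))" for xs ys
  proof -
    have ge: "opnorm (transfer t zs) \<ge> 1" for zs by (rule opnorm_ge_1[OF det_transfer])
    have "ln (opnorm (transfer t (xs @ ys))) \<le> ln (opnorm (transfer t xs) * opnorm (transfer t ys))"
      using ge[of "xs @ ys"] opnorm_mult[of "transfer t xs" "transfer t ys"] unfolding transfer_append by simp
    also have "\<dots> = ln (opnorm (transfer t xs)) + ln (opnorm (transfer t ys))"
      using ge[of xs] ge[of ys] by (intro ln_mult_pos) auto
    finally show ?thesis using ln_opnorm_transfer_nonneg by (simp flip: ennreal_plus add: ennreal_leI)
  qed
  have "F (m + n) = (\<integral>\<^sup>+xs. \<integral>\<^sup>+ys. ennreal (ln (opnorm (transfer t (xs @ ys)))) \<partial>replicate_pmf n D \<partial>replicate_pmf m D)"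
    unfolding F_def replicate_pmf_distrib by simp
  also have "\<dots> \<le> (\<integral>\<^sup>+xs. \<integral>\<^sup>+ys. ennreal (ln (opnorm (transfer t xs))) + ennreal (ln (opnorm (transfer t ys))) \<partial>replicate_pmf n D \<partial>replicate_pmf m D)"
    by (intro nn_integral_mono le)
  also have "\<dots> = F m + F n" unfolding F_def
    by (simp add: nn_integral_add measure_pmf.emeasure_space_1)
  finally show ?thesis .
qed

text \<open>The logarithms of the norm and of the continuant differ by a bounded amount, which disappears after
  division by \<open>n\<close>; the existence of the limit comes from subadditivity.\<close>

lemma lyapunov_exponent_limit:
  fixes D :: "real pmf" and t :: complex
  assumes t: "Im t > 0"
    and D: "(\<integral>\<^sup>+a. ennreal (ln (opnorm (schroedinger_matrix (of_real a - t)))) \<partial>D) < \<infinity>"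
  shows integrable_ln_continuant: "integrable (replicate_pmf n D) (\<lambda>xs. ln (cmod (transfer t xs $1$1)))"
    and ln_continuant_tendsto: "(\<lambda>n. 1 / real n * (\<integral>xs. ln (cmod (transfer t xs $1$1)) \<partial>replicate_pmf n D)) \<longlonglongrightarrow>
       lyapunov_exponent (distr (measure_pmf D) borel (\<lambda>a. schroedinger_matrix (of_real a - t)))"
proof -
  define F where "F n = (\<integral>\<^sup>+xs. ennreal (ln (opnorm (transfer t xs))) \<partial>replicate_pmf n D)" for n
  have sub: "F (m + n) \<le> F m + F n" for m n unfolding F_def by (rule nn_integral_transfer_subadditive)
  have F1: "F 1 < \<infinity>" using D unfolding F_def replicate_pmf_1 by simp
  have fin: "F n < \<infinity>" for n
  proof (induction n)
    case 0
    have "opnorm (mat 1 :: complex^2^2) = 1"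
    proof -
      have "(*v) (mat 1 :: complex^2^2) = (\<lambda>x. x)" by auto
      then show ?thesis by (simp only: onorm_id)
    qed
    then show ?case by (simp add: F_def)
  next
    case (Suc n)
    then show ?case using sub[of 1 n] F1 by (simp add: less_top[symmetric]) (metis ennreal_add_eq_top top.extremum_uniqueI)
  qed
  have int: "integrable (replicate_pmf n D) (\<lambda>xs. ln (opnorm (transfer t xs)))" for n
    using fin[of n] ln_opnorm_transfer_nonneg by (intro integrableI_bounded) (auto simp: F_def)
  define u where "u n = (\<integral>xs. ln (opnorm (transfer t xs)) \<partial>replicate_pmf n D)" for n
  have uF: "ennreal (u n) = F n" for n
    unfolding u_def F_def using int ln_opnorm_transfer_nonneg
    by (intro nn_integral_eq_integral[symmetric]) auto
  have u0: "u n \<ge> 0" for n unfolding u_def using ln_opnorm_transfer_nonneg by (intro Bochner_Integration.integral_nonneg) auto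
  have "u (m + n) \<le> u m + u n" for m n
    using sub[of m n] u0 unfolding uF[symmetric] by (simp flip: ennreal_plus)
  then have conv: "convergent (\<lambda>n. 1 / real n * u n)" using u0 by (intro fekete)
  define \<Lambda> where "\<Lambda> = lyapunov_exponent (distr (measure_pmf D) borel (\<lambda>a. schroedinger_matrix (of_real a - t)))"
  have "\<Lambda> = lim (\<lambda>n. 1 / real n * u n)"
    unfolding \<Lambda>_def lyapunov_exponent_def convolution_power_transfer u_def
    by (subst integral_distr) auto
  then have lim: "(\<lambda>n. 1 / real n * u n) \<longlonglongrightarrow> \<Lambda>"
    using conv by (simp add: convergent_LIMSEQ_iff)
  define C where "C = 2 + 2 / Im t + 1 / (Im t)\<^sup>2"
  have C: "C > 0" using t by (simp add: C_def add_pos_pos)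
  have nz: "cmod (transfer t xs $1$1) > 0" for xs
    using continuant_nonreal[of t] t transfer_first_column[of t xs] by simp
  have close: "\<bar>ln (opnorm (transfer t xs)) - ln (cmod (transfer t xs $1$1))\<bar> \<le> ln C" for xs
  proof -
    have "ln (opnorm (transfer t xs)) \<le> ln (C * cmod (transfer t xs $1$1))"
      using opnorm_transfer_le[OF t, of xs] opnorm_ge_1[OF det_transfer[of t xs]] unfolding C_def by simp
    then have "ln (opnorm (transfer t xs)) \<le> ln C + ln (cmod (transfer t xs $1$1))"
      using C nz[of xs] by (simp add: ln_mult_pos)
    moreover have "ln (cmod (transfer t xs $1$1)) \<le> ln (opnorm (transfer t xs))"
      using norm_entry_le_opnorm[of "transfer t xs"] nz[of xs] opnorm_ge_1[OF det_transfer[of t xs]] by simp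
    ultimately show ?thesis by linarith
  qed
  have int2: "integrable (replicate_pmf n D) (\<lambda>xs. ln (opnorm (transfer t xs)) - ln (cmod (transfer t xs $1$1)))" for n
    using close by (intro measure_pmf.integrable_const_bound[where B="ln C"]) auto
  show int3: "integrable (replicate_pmf n D) (\<lambda>xs. ln (cmod (transfer t xs $1$1)))" for n
    using Bochner_Integration.integrable_diff[OF int int2, of n] by simp
  define w where "w n = (\<integral>xs. ln (cmod (transfer t xs $1$1)) \<partial>replicate_pmf n D)" for n
  have uw: "\<bar>u n - w n\<bar> \<le> ln C" for n
  proof -
    have "\<bar>u n - w n\<bar> = \<bar>\<integral>xs. ln (opnorm (transfer t xs)) - ln (cmod (transfer t xs $1$1)) \<partial>replicate_pmf n D\<bar>"
      unfolding u_def w_def using int int3 by simp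
    also have "\<dots> \<le> (\<integral>xs. \<bar>ln (opnorm (transfer t xs)) - ln (cmod (transfer t xs $1$1))\<bar> \<partial>replicate_pmf n D)"
      by (rule integral_abs_bound)
    also have "\<dots> \<le> (\<integral>xs. ln C \<partial>replicate_pmf n D)"
      using int2 close by (intro integral_mono) auto
    finally show ?thesis by simp
  qed
  have "(\<lambda>n. 1 / real n * (u n - w n)) \<longlonglongrightarrow> 0"
  proof (rule tendsto_rabs_zero_cancel, rule tendsto_sandwich[where f="\<lambda>_. 0" and h="\<lambda>n. ln C * (1 / real n)"])
    show "\<forall>\<^sub>F n in sequentially. \<bar>1 / real n * (u n - w n)\<bar> \<le> ln C * (1 / real n)"
      using uw by (auto simp: abs_mult intro!: always_eventually divide_right_mono)
    show "(\<lambda>n. ln C * (1 / real n)) \<longlonglongrightarrow> 0" by (intro tendsto_mult_right_zero lim_1_over_n)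
  qed auto
  from tendsto_diff[OF lim this] show "(\<lambda>n. 1 / real n * (\<integral>xs. ln (cmod (transfer t xs $1$1)) \<partial>replicate_pmf n D)) \<longlonglongrightarrow>
       lyapunov_exponent (distr (measure_pmf D) borel (\<lambda>a. schroedinger_matrix (of_real a - t)))"
    unfolding \<Lambda>_def w_def by (simp add: algebra_simps)
qed

section \<open>Resonant blocks in a random word\<close>

lemma pmf_replicate_pmf_Cons:
  "pmf (replicate_pmf (Suc n) D) (x # xs) = pmf D x * pmf (replicate_pmf n D) xs"
proof -
  have e: "replicate_pmf (Suc n) D = map_pmf (\<lambda>(x, xs). x # xs) (pair_pmf D (replicate_pmf n D))"
    by (simp add: pair_pmf_def map_bind_pmf map_pmf_def bind_assoc_pmf bind_return_pmf)
  have "inj (\<lambda>(x, xs). x # xs)" by (auto simp: inj_on_def)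
  from pmf_map_inj'[OF this, of "pair_pmf D (replicate_pmf n D)" "(x, xs)"]
  show ?thesis unfolding e by (simp add: pmf_pair)
qed

text \<open>Only occurrences at multiples of the block length are recorded: the test vectors attached to them
  have disjoint supports, and the number of occurrences is additive when a word is extended by one block length.\<close>

definition block_positions :: "real list \<Rightarrow> nat \<Rightarrow> real list \<Rightarrow> nat set" where
  "block_positions b m xs = {i. i < m \<and> (\<forall>j<length b. sites xs (length b * i + j) = b ! j)}"

lemma finite_block_positions [simp]: "finite (block_positions b m xs)"
  by (simp add: block_positions_def)

lemma card_block_positions_append:
  assumes "length zs = length b" "length ys = length b * m"
  shows "card (block_positions b (Suc m) (zs @ ys))
    = card (block_positions b m ys) + (if zs = rev b then 1 else 0)"
proof -
  have old: "sites (zs @ ys) k = sites ys k" if "k < length b * m" for k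
    using that assms by (simp add: nth_append)
  have new: "sites (zs @ ys) (length b * m + j) = rev zs ! j" for j
    using assms by (simp add: nth_append)
  have lt: "length b * i + j < length b * m" if "i < m" "j < length b" for i j
  proof -
    have "length b * i + j < length b * Suc i" using that by simp
    also have "\<dots> \<le> length b * m" using that by (intro mult_left_mono) auto
    finally show ?thesis .
  qed
  have last: "(\<forall>j<length b. rev zs ! j = b ! j) \<longleftrightarrow> zs = rev b"
    using assms(1) by (metis length_rev nth_equalityI rev_rev_ident)
  have "block_positions b (Suc m) (zs @ ys) = block_positions b m ys \<union> (if zs = rev b then {m} else {})"
  proof (intro set_eqI)
    fix i
    consider "i < m" | "i = m" | "i > m" by linarith
    then show "i \<in> block_positions b (Suc m) (zs @ ys) \<longleftrightarrow>
        i \<in> block_positions b m ys \<union> (if zs = rev b then {m} else {})"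
    proof cases
      case 1
      then show ?thesis unfolding block_positions_def using old lt by auto
    next
      case 2
      then show ?thesis unfolding block_positions_def using new last by auto
    qed (auto simp: block_positions_def)
  qed
  moreover have "m \<notin> block_positions b m ys" by (simp add: block_positions_def)
  ultimately show ?thesis by simp
qed

lemma expected_block_positions:
  "(\<integral>\<^sup>+xs. ennreal (card (block_positions b m xs)) \<partial>replicate_pmf (length b * m) D)
     = ennreal (real m * pmf (replicate_pmf (length b) D) (rev b))"
proof (induction m)
  case 0
  then show ?case by (simp add: block_positions_def)
next
  case (Suc m)
  let ?W = "\<lambda>n. replicate_pmf n D" and ?q = "pmf (replicate_pmf (length b) D) (rev b)"
  have "(\<integral>\<^sup>+xs. ennreal (card (block_positions b (Suc m) xs)) \<partial>?W (length b * Suc m))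
     = (\<integral>\<^sup>+zs. \<integral>\<^sup>+ys. ennreal (card (block_positions b (Suc m) (zs @ ys))) \<partial>?W (length b * m) \<partial>?W (length b))"
    unfolding mult_Suc_right replicate_pmf_distrib by simp
  also have "\<dots> = (\<integral>\<^sup>+zs. \<integral>\<^sup>+ys. ennreal (card (block_positions b m ys)) + indicator {rev b} zs \<partial>?W (length b * m) \<partial>?W (length b))"
    by (intro nn_integral_cong_AE AE_pmfI)
      (auto simp: set_replicate_pmf card_block_positions_append)
  also have "\<dots> = ennreal (real m * ?q) + emeasure (?W (length b)) {rev b}"
    by (simp add: nn_integral_add Suc measure_pmf.emeasure_space_1)
  also have "\<dots> = ennreal (real (Suc m) * ?q)"
    by (simp add: emeasure_pmf_single flip: ennreal_plus) (simp add: algebra_simps)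
  finally show ?case .
qed

lemma sum_single_le:
  fixes C :: real and c n :: nat
  assumes "C \<ge> 0" shows "(\<Sum>k<n. if k = c then C else 0) \<le> C"
  using assms by (cases "c < n") auto

text \<open>The error of a vector supported on five consecutive sites lives on these sites and on the two
  neighbouring ones. It is an inequality because a neighbour may lie outside \<open>{..<n}\<close>.\<close>

lemma block_test_vector:
  fixes a :: "nat \<Rightarrow> real" and w0 w1 w2 w3 w4 E :: real and c n :: nat
  defines "u \<equiv> \<lambda>k. if c \<le> k \<and> k < c + 5 then [w0, w1, w2, w3, w4] ! (k - c) else 0"
  shows "(\<Sum>k<n. (jacobi_op a u k - E * u k)\<^sup>2)
    \<le> w0\<^sup>2 + ((a c - E) * w0 - w1)\<^sup>2 + ((a (c+1) - E) * w1 - w0 - w2)\<^sup>2 + ((a (c+2) - E) * w2 - w1 - w3)\<^sup>2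
      + ((a (c+3) - E) * w3 - w2 - w4)\<^sup>2 + ((a (c+4) - E) * w4 - w3)\<^sup>2 + w4\<^sup>2" (is "_ \<le> ?R")
    and "c + 5 \<le> n \<Longrightarrow> (\<Sum>k<n. (u k)\<^sup>2) = w0\<^sup>2 + w1\<^sup>2 + w2\<^sup>2 + w3\<^sup>2 + w4\<^sup>2"
proof -
  have u: "u c = w0" "u (c+1) = w1" "u (c+2) = w2" "u (c+3) = w3" "u (c+4) = w4"
    "k < c \<Longrightarrow> u k = 0" "k \<ge> c + 5 \<Longrightarrow> u k = 0" for k
    by (auto simp: u_def)
  define r where "r k = jacobi_op a u k - E * u k" for k
  define c1 where "c1 = Suc c"
  define c2 where "c2 = Suc c1"
  define c3 where "c3 = Suc c2"
  define c4 where "c4 = Suc c3"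
  define c5 where "c5 = Suc c4"
  note c_defs = c1_def c2_def c3_def c4_def c5_def
  have cs: "c + 1 = c1" "c + 2 = c2" "c + 3 = c3" "c + 4 = c4" "c + 5 = c5"
    by (simp_all add: c_defs)
  have u5: "u (Suc c5) = 0" "u c5 = 0" using u(7)[of "Suc c5"] u(7)[of c5] by (simp_all add: c_defs)
  note u = u[unfolded cs] u5
  have rS: "r (Suc k) = (a (Suc k) - E) * u (Suc k) - u k - u (Suc (Suc k))" for k
    by (simp add: r_def jacobi_op_def algebra_simps)
  \<comment> \<open>The squared errors site by site; \<open>s\<close> is the left neighbour, which is absent for \<open>c = 0\<close>.\<close>
  define t where "t e C k = (if k = e then (C::real)\<^sup>2 else 0)" for e k :: nat and C
  define s where "s k = (if c > 0 then t (c-1) w0 k else 0)" for k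
  define g where "g k = t c5 w4 k + (t c ((a c - E) * w0 - w1) k + t c1 ((a c1 - E) * w1 - w0 - w2) k
      + t c2 ((a c2 - E) * w2 - w1 - w3) k + t c3 ((a c3 - E) * w3 - w2 - w4) k
      + t c4 ((a c4 - E) * w4 - w3) k) + s k" for k
  have t0: "t e C k \<ge> 0" "s k \<ge> 0" for e C k by (simp_all add: t_def s_def)
  have tt: "t e C e = C\<^sup>2" for e C by (simp add: t_def)
  have gt: "t c5 w4 k \<le> g k" "t c ((a c - E) * w0 - w1) k \<le> g k" "t c1 ((a c1 - E) * w1 - w0 - w2) k \<le> g k"
    "t c2 ((a c2 - E) * w2 - w1 - w3) k \<le> g k" "t c3 ((a c3 - E) * w3 - w2 - w4) k \<le> g k"
    "t c4 ((a c4 - E) * w4 - w3) k \<le> g k" "s k \<le> g k" "0 \<le> g k" for k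
    unfolding g_def using t0(2)[of k] t0(1)[of c5 w4 k] t0(1)[of c "(a c - E) * w0 - w1" k]
      t0(1)[of c1 "(a c1 - E) * w1 - w0 - w2" k] t0(1)[of c2 "(a c2 - E) * w2 - w1 - w3" k]
      t0(1)[of c3 "(a c3 - E) * w3 - w2 - w4" k] t0(1)[of c4 "(a c4 - E) * w4 - w3" k] by linarith+
  have "(r k)\<^sup>2 \<le> g k" for k
  proof -
    consider "k = c" | "k = c1" | "k = c2" | "k = c3" | "k = c4" | "k = c5" | "k > c5" | "c > 0" "k = c - 1" | "k + 1 < c"
    proof -
      have "k > c \<Longrightarrow> k = c1 \<or> k > c1" "k > c1 \<Longrightarrow> k = c2 \<or> k > c2" "k > c2 \<Longrightarrow> k = c3 \<or> k > c3"
        "k > c3 \<Longrightarrow> k = c4 \<or> k > c4" "k > c4 \<Longrightarrow> k = c5 \<or> k > c5"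
        by (auto simp: c_defs)
      moreover have "k < c \<Longrightarrow> (c > 0 \<and> k = c - 1) \<or> k + 1 < c" by linarith
      ultimately show ?thesis using that linorder_less_linear[of k c] by blast
    qed
    then show ?thesis
    proof cases
      case 1
      have "r c = (a c - E) * w0 - w1"
      proof (cases c)
        case 0
        have "u (Suc c) = w1" using u(2) by (simp only: c1_def)
        then show ?thesis using u(1) by (simp add: r_def jacobi_op_def 0 algebra_simps)
      next
        case (Suc b)
        have "u b = 0" "u (Suc c) = w1" using u(2) u(6)[of b] Suc by (simp_all only: c1_def lessI)
        then show ?thesis using u(1) rS[of b] unfolding Suc by simp
      qed
      then show ?thesis using gt(2)[of c] unfolding 1 tt by simp
    next
      case 2
      have "r k = (a c1 - E) * w1 - w0 - w2"
        using rS[of c] unfolding 2 c_defs[symmetric] by (simp add: u)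
      then show ?thesis using gt(3)[of c1] unfolding 2 tt by simp
    next
      case 3
      have "r k = (a c2 - E) * w2 - w1 - w3"
        using rS[of c1] unfolding 3 c_defs[symmetric] by (simp add: u)
      then show ?thesis using gt(4)[of c2] unfolding 3 tt by simp
    next
      case 4
      have "r k = (a c3 - E) * w3 - w2 - w4"
        using rS[of c2] unfolding 4 c_defs[symmetric] by (simp add: u)
      then show ?thesis using gt(5)[of c3] unfolding 4 tt by simp
    next
      case 5
      have "r k = (a c4 - E) * w4 - w3"
        using rS[of c3] unfolding 5 c_defs[symmetric] by (simp add: u)
      then show ?thesis using gt(6)[of c4] unfolding 5 tt by simp
    next
      case 6
      have "r k = - w4"
        using rS[of c4] unfolding 6 c_defs[symmetric] by (simp add: u)
      then show ?thesis using gt(1)[of c5] unfolding 6 tt by simp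
    next
      case 7
      then obtain b where b: "k = Suc b" by (cases k) auto
      have "r k = 0"
        unfolding b rS using u(7)[of b] u(7)[of "Suc b"] u(7)[of "Suc (Suc b)"] 7 b by simp
      then show ?thesis using gt(8)[of k] by simp
    next
      case 8
      then have c: "c = Suc k" by simp
      have "r k = - w0"
      proof (cases k)
        case 0
        then show ?thesis using u(1) u(6)[of k] c by (simp add: r_def jacobi_op_def)
      next
        case (Suc b)
        then show ?thesis using u(1) u(6)[of k] u(6)[of b] c rS[of b] by simp
      qed
      then show ?thesis using gt(7)[of k] 8 by (simp add: s_def t_def)
    next
      case 9
      have "r k = 0"
        using u(6)[of k] u(6)[of "k-1"] u(6)[of "Suc k"] 9 by (simp add: r_def jacobi_op_def)
      then show ?thesis using gt(8)[of k] by simp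
    qed
  qed
  then have "(\<Sum>k<n. (r k)\<^sup>2) \<le> (\<Sum>k<n. g k)" by (intro sum_mono)
  also have "\<dots> \<le> w4\<^sup>2 + (((a c - E) * w0 - w1)\<^sup>2 + ((a c1 - E) * w1 - w0 - w2)\<^sup>2 + ((a c2 - E) * w2 - w1 - w3)\<^sup>2
      + ((a c3 - E) * w3 - w2 - w4)\<^sup>2 + ((a c4 - E) * w4 - w3)\<^sup>2) + w0\<^sup>2"
  proof -
    have "(\<Sum>k<n. t e C k) \<le> C\<^sup>2" for e C
      unfolding t_def by (rule sum_single_le) simp
    moreover from this have "(\<Sum>k<n. s k) \<le> w0\<^sup>2"
      by (cases "c > 0") (simp_all add: s_def)
    ultimately show ?thesis
      unfolding g_def sum.distrib by (intro add_mono)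
  qed
  finally show "(\<Sum>k<n. (jacobi_op a u k - E * u k)\<^sup>2) \<le> ?R" by (simp only: r_def cs)
  show "(\<Sum>k<n. (u k)\<^sup>2) = w0\<^sup>2 + w1\<^sup>2 + w2\<^sup>2 + w3\<^sup>2 + w4\<^sup>2" if n: "c + 5 \<le> n"
  proof -
    have "(\<Sum>k<n. (u k)\<^sup>2) = (\<Sum>k\<in>{c, c1, c2, c3, c4}. (u k)\<^sup>2)"
    proof (rule sum.mono_neutral_right)
      show "\<forall>i\<in>{..<n} - {c, c1, c2, c3, c4}. (u i)\<^sup>2 = 0"
      proof
        fix i assume "i \<in> {..<n} - {c, c1, c2, c3, c4}"
        then have "i < c \<or> i \<ge> c5" by (auto simp: c_defs)
        then show "(u i)\<^sup>2 = 0" using u(6,7) by auto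
      qed
    qed (use n in \<open>auto simp: c_defs\<close>)
    also have "\<dots> = (u c)\<^sup>2 + (u c1)\<^sup>2 + (u c2)\<^sup>2 + (u c3)\<^sup>2 + (u c4)\<^sup>2"
      by (simp add: c_defs)
    finally show ?thesis by (simp only: u)
  qed
qed

text \<open>The opposite signs of the walls \<open>V\<close> and \<open>-V\<close> make \<open>x + z\<close> of order \<open>V\<^sup>-\<^sup>2\<close>. The outer sites, at
  distance \<open>d\<close> from the energy, reduce what leaks out of the block from order \<open>1 / V\<close> to order
  \<open>1 / (d V)\<close>: with \<open>d \<ge> 40\<close> a window of half-width \<open>1 / (4 V)\<close> captures
  the block.\<close>

lemma resonant_block_estimates:
  fixes V E d :: real
  assumes E: "E > 0" and d: "d \<ge> 40" and V: "V \<ge> 50 * E" "V \<ge> 50"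
  defines "x \<equiv> 1 / (V - E)" and "z \<equiv> - 1 / (V + E)"
  shows "2 * (x / d)\<^sup>2 + 2 * (z / d)\<^sup>2 + (x + z)\<^sup>2 \<le> (1 / (4 * V))\<^sup>2 / 2"
    and "(x / d)\<^sup>2 + x\<^sup>2 + 1 + z\<^sup>2 + (z / d)\<^sup>2 \<le> 2"
proof -
  have pos: "V > 0" "V - E > 0" "V + E > 0" using assms by auto
  have x: "0 \<le> x" "x \<le> 2 / V" using pos V by (auto simp: x_def field_simps)
  have z: "0 \<le> - z" "- z \<le> 2 / V" using pos V E by (auto simp: z_def field_simps)
  have xz: "0 \<le> x + z" "x + z \<le> 1 / (20 * V)"
  proof -
    have e: "x + z = 2 * E / ((V - E) * (V + E))" using pos by (simp add: x_def z_def field_simps)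
    then show "0 \<le> x + z" using pos E by simp
    have "2 * E * (20 * V) \<le> (V - E) * (V + E)"
    proof -
      have "50 * E * V \<le> V * V" using V pos by (intro mult_right_mono) auto
      moreover have "E * E \<le> E * V" using E V by (intro mult_left_mono) auto
      moreover have "0 \<le> E * V" using E pos by simp
      ultimately show ?thesis by (simp add: algebra_simps)
    qed
    then show "x + z \<le> 1 / (20 * V)" unfolding e using pos by (simp add: divide_simps)
  qed
  have sq: "t\<^sup>2 \<le> 4 / V\<^sup>2" if "0 \<le> t" "t \<le> 2 / V" for t
    using power_mono[OF that(2,1), of 2] by (simp add: power_divide)
  have x2: "x\<^sup>2 \<le> 4 / V\<^sup>2" by (rule sq[OF x])
  have z2: "z\<^sup>2 \<le> 4 / V\<^sup>2" using sq[OF z] by simp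
  have d2: "d\<^sup>2 \<ge> 1600" using power_mono[OF d, of 2] by simp
  have xd: "(t / d)\<^sup>2 \<le> t\<^sup>2 / 1600" for t
    unfolding power_divide using d2 by (intro divide_left_mono) auto
  have xz2: "(x + z)\<^sup>2 \<le> 1 / (400 * V\<^sup>2)"
    using power_mono[OF xz(2,1), of 2] by (simp add: power_divide power_mult_distrib)
  have r: "1 / (400 * V\<^sup>2) = (1 / V\<^sup>2) / 400" "4 / V\<^sup>2 = 4 * (1 / V\<^sup>2)" "(1 / (4 * V))\<^sup>2 / 2 = (1 / V\<^sup>2) / 32"
    by (simp_all add: power_divide power_mult_distrib)
  have V2: "0 \<le> 1 / V\<^sup>2" by simp
  have lin: "2 * A' + 2 * B' + S \<le> T / 32" "A' + A + 1 + B + B' \<le> 1 + 9 * T"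
    if "A \<le> 4 * T" "B \<le> 4 * T" "A' \<le> A / 1600" "B' \<le> B / 1600" "S \<le> T / 400" "0 \<le> T"
    for A B A' B' S T :: real
    using that by linarith+
  show "2 * (x / d)\<^sup>2 + 2 * (z / d)\<^sup>2 + (x + z)\<^sup>2 \<le> (1 / (4 * V))\<^sup>2 / 2"
    using lin(1)[of "x\<^sup>2" "1 / V\<^sup>2" "z\<^sup>2" "(x / d)\<^sup>2" "(z / d)\<^sup>2" "(x + z)\<^sup>2"] x2 z2 xd xz2 V2
    unfolding r by blast
  have "1 / V\<^sup>2 \<le> 1 / 2500" using power_mono[OF V(2), of 2] by (intro divide_left_mono) auto
  then show "(x / d)\<^sup>2 + x\<^sup>2 + 1 + z\<^sup>2 + (z / d)\<^sup>2 \<le> 2"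
    using lin(2)[of "x\<^sup>2" "1 / V\<^sup>2" "z\<^sup>2" "(x / d)\<^sup>2" "(z / d)\<^sup>2" "(x + z)\<^sup>2"] x2 z2 xd[of x] xd[of z] xz2 V2
    unfolding r by linarith
qed

text \<open>The test vector \<open>(x/d, x, 1, z, z/d)\<close> solves the eigenvalue equation exactly at the outer sites, while
  \<open>x\<close> and \<open>z\<close> compensate the value \<open>1\<close> at the two walls.\<close>

lemma spectral_mass_ge_blocks:
  fixes xs :: "real list" and E V U :: real
  assumes E: "E > 0" and d: "U - E \<ge> 40" and V: "V \<ge> 50 * E" "V \<ge> 50"
    and len: "length xs = 5 * m"
    and G0: "\<And>x. G x \<ge> 0" and G: "\<And>x. \<bar>x - E\<bar> \<le> 1 / (4 * V) \<Longrightarrow> G x \<ge> 1 / 2"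
  shows "(\<Sum>x\<in>spectrum (sites xs) (length xs). G x) \<ge> real (card (block_positions [U, V, E, - V, U] m xs)) / 8"
proof -
  let ?b = "[U, V, E, - V, U]" and ?a = "sites xs"
  define d where "d = U - E"
  define x where "x = 1 / (V - E)"
  define z where "z = - 1 / (V + E)"
  define u where "u i k = (if 5 * i \<le> k \<and> k < 5 * i + 5 then [x / d, x, 1, z, z / d] ! (k - 5 * i) else 0)" for i k
  have nz: "V - E \<noteq> 0" "V + E \<noteq> 0" "d \<noteq> 0" using assms by (auto simp: d_def)
  note est = resonant_block_estimates[OF E, of d V, folded x_def z_def]
  have d40: "d \<ge> 40" using d by (simp add: d_def)
  show ?thesis
  proof (rule spectral_mass_lower_bound[where u=u and supp="\<lambda>i. {5*i..<5*i+5}" and E=E and \<delta>="1/(4*V)"])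
    fix i assume i: "i \<in> block_positions ?b m xs"
    then have im: "5 * i + 5 \<le> length xs" by (auto simp: block_positions_def len)
    have lb: "length ?b = 5" by simp
    have "\<forall>j<length ?b. ?a (length ?b * i + j) = ?b ! j"
      using i[unfolded block_positions_def mem_Collect_eq] by (rule conjunct2)
    then have a: "?a (5 * i + j) = ?b ! j" if "j < 5" for j
      using that unfolding lb by blast
    have as: "?a (5 * i) = U" "?a (5 * i + 1) = V" "?a (5 * i + 2) = E" "?a (5 * i + 3) = - V" "?a (5 * i + 4) = U"
      using a[of 0] a[of 1] a[of 2] a[of 3] a[of 4] by (simp_all add: numeral_eq_Suc)
    show "{5 * i..<5 * i + 5} \<subseteq> {..<length xs}" using im by auto
    show "u i k = 0" if "k \<notin> {5 * i..<5 * i + 5}" for k using that by (auto simp: u_def)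
    have nrm: "(\<Sum>k<length xs. (u i k)\<^sup>2) = (x / d)\<^sup>2 + x\<^sup>2 + 1\<^sup>2 + z\<^sup>2 + (z / d)\<^sup>2"
      unfolding u_def by (rule block_test_vector(2)[OF im])
    show "1 \<le> (\<Sum>k<length xs. (u i k)\<^sup>2)" unfolding nrm by simp
    show "(\<Sum>k<length xs. (u i k)\<^sup>2) \<le> 2" unfolding nrm using est(2)[OF d40 V] by simp
    have "(\<Sum>k<length xs. (jacobi_op ?a (u i) k - E * u i k)\<^sup>2)
      \<le> (x / d)\<^sup>2 + ((U - E) * (x / d) - x)\<^sup>2 + ((V - E) * x - x / d - 1)\<^sup>2 + ((E - E) * 1 - x - z)\<^sup>2
        + ((- V - E) * z - 1 - z / d)\<^sup>2 + ((U - E) * (z / d) - z)\<^sup>2 + (z / d)\<^sup>2"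
      using block_test_vector(1)[of ?a "5 * i" "x / d" x 1 z "z / d" E "length xs"] unfolding as u_def .
    moreover have "(U - E) * (x / d) - x = 0" "(U - E) * (z / d) - z = 0"
      using nz unfolding d_def[symmetric] by auto
    moreover have "(V - E) * x - x / d - 1 = - (x / d)" using nz by (simp add: x_def)
    moreover have "(- V - E) * z - 1 - z / d = - (z / d)"
    proof -
      have "- V - E = - (V + E)" "z = - (1 / (V + E))" by (simp_all add: z_def)
      then have "(- V - E) * z = (V + E) * (1 / (V + E))" by (simp only: minus_mult_minus)
      also have "\<dots> = 1" using nz by simp
      finally show ?thesis by linarith
    qed
    moreover have "(E - E) * 1 - x - z = - (x + z)" by simp
    ultimately have "(\<Sum>k<length xs. (jacobi_op ?a (u i) k - E * u i k)\<^sup>2)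
      \<le> 2 * (x / d)\<^sup>2 + 2 * (z / d)\<^sup>2 + (x + z)\<^sup>2"
      by (simp only: power2_minus) simp
    also have "\<dots> \<le> (1 / (4 * V))\<^sup>2 / 2" by (rule est(1)[OF d40 V])
    finally show "(\<Sum>k<length xs. (jacobi_op ?a (u i) k - E * u i k)\<^sup>2) \<le> (1 / (4 * V))\<^sup>2 / 2" .
  next
    show "disjoint_family_on (\<lambda>i. {5 * i..<5 * i + 5}) (block_positions ?b m xs)"
      unfolding disjoint_family_on_def
    proof (intro ballI impI)
      fix i j :: nat assume "i \<noteq> j"
      then show "{5 * i..<5 * i + 5} \<inter> {5 * j..<5 * j + 5} = {}" by auto
    qed
    show "1 / (4 * V) > 0" using V by simp
  qed (use G0 G in auto)
qed

section \<open>From eigenvalues to the integrated density of states\<close>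

text \<open>A probability mass function charges only countably many points, so joint measurability is automatic and Tonelli's theorem applies
  on any type.\<close>

lemma nn_integral_pmf_swap:
  fixes p :: "'a pmf" and f :: "'a \<Rightarrow> 'b \<Rightarrow> ennreal"
  assumes [measurable]: "\<And>i. f i \<in> borel_measurable M"
  shows measurable_nn_integral_pmf: "(\<lambda>x. \<integral>\<^sup>+i. f i x \<partial>p) \<in> borel_measurable M"
    and "(\<integral>\<^sup>+x. \<integral>\<^sup>+i. f i x \<partial>p \<partial>M) = (\<integral>\<^sup>+i. \<integral>\<^sup>+x. f i x \<partial>M \<partial>p)"
proof -
  let ?C = "count_space (set_pmf p)"
  have e: "(\<integral>\<^sup>+i. h i \<partial>p) = (\<integral>\<^sup>+i. ennreal (pmf p i) * h i \<partial>?C)" for h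
    unfolding nn_integral_measure_pmf
    by (rule nn_integral_count_space_eq) (auto simp: set_pmf_iff)
  interpret sigma_finite_measure ?C
    by (rule sigma_finite_measure_count_space_countable) simp
  have "(\<lambda>z. ennreal (pmf p (fst z)) * f (fst z) (snd z)) \<in> borel_measurable (?C \<Otimes>\<^sub>M M)"
    by (rule measurable_pair_measure_countable1) auto
  from measurable_pair_swap[OF this]
  have "(\<lambda>(x, i). ennreal (pmf p i) * f i x) \<in> borel_measurable (M \<Otimes>\<^sub>M ?C)"
    by (simp add: case_prod_beta)
  from borel_measurable_nn_integral[OF this]
  show "(\<lambda>x. \<integral>\<^sup>+i. f i x \<partial>p) \<in> borel_measurable M" unfolding e by simp
  show "(\<integral>\<^sup>+x. \<integral>\<^sup>+i. f i x \<partial>p \<partial>M) = (\<integral>\<^sup>+i. \<integral>\<^sup>+x. f i x \<partial>M \<partial>p)"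
    unfolding e by (subst nn_integral_count_space_nn_integral) (auto simp: nn_integral_cmult)
qed

text \<open>The integral of \<open>G\<close> against the eigenvalue counting measure of the word.\<close>

definition spectral_sum :: "(real \<Rightarrow> real) \<Rightarrow> real list \<Rightarrow> real" where
  "spectral_sum G xs = (\<Sum>x\<in>spectrum (sites xs) (length xs). G x)"

lemma spectral_sum_log_kernel:
  assumes y: "y > 0"
  shows "spectral_sum (\<lambda>s. log_kernel y (x - s)) xs
    = ln (cmod (transfer (Complex x (2 * y)) xs $1$1)) - ln (cmod (transfer (Complex x y) xs $1$1))"
proof -
  have pos: "cmod (Complex x z - of_real s) > 0" if "z > 0" for z s
    using that by (auto simp: complex_eq_iff)
  have "ln (cmod (transfer (Complex x z) xs $1$1))
      = (\<Sum>s\<in>spectrum (sites xs) (length xs). ln (cmod (Complex x z - of_real s)))" if "z > 0" for z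
  proof -
    have "cmod (transfer (Complex x z) xs $1$1)
        = (\<Prod>s\<in>spectrum (sites xs) (length xs). cmod (Complex x z - of_real s))"
      using transfer_first_column[of "Complex x z" xs] by (simp only: cmod_continuant)
    moreover have "cmod (Complex x z - of_real s) \<noteq> 0" for s using pos[OF that, of s] by simp
    ultimately show ?thesis by (simp only:) (intro ln_prod finite_spectrum; blast)
  qed
  from this[of "2 * y"] this[of y] y show ?thesis
    unfolding spectral_sum_def log_kernel_eq[OF y] sum_subtractf by simp
qed

lemma spectral_sum_bounds:
  assumes "y > 0"
  shows "0 \<le> spectral_sum (\<lambda>s. log_kernel y (x - s)) xs"
    and "spectral_sum (\<lambda>s. log_kernel y (x - s)) xs \<le> real (length xs) * ln 2"
proof -
  show "0 \<le> spectral_sum (\<lambda>s. log_kernel y (x - s)) xs"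
    unfolding spectral_sum_def by (intro sum_nonneg log_kernel_bounds(1)[OF assms])
  show "spectral_sum (\<lambda>s. log_kernel y (x - s)) xs \<le> real (length xs) * ln 2"
    using sum_bounded_above[of "spectrum (sites xs) (length xs)" "\<lambda>s. log_kernel y (x - s)" "ln 2"]
      log_kernel_bounds(2)[OF assms] unfolding spectral_sum_def card_spectrum by blast
qed

lemma nn_integral_spectral_sum:
  assumes y: "y > 0" and ab: "\<alpha> \<le> \<beta>"
  shows "(\<integral>\<^sup>+x. ennreal (spectral_sum (\<lambda>s. log_kernel y (x - s)) xs) * indicator {\<alpha>..\<beta>} x \<partial>lborel)
    = ennreal (pi * y * spectral_sum (smooth_indicator y \<alpha> \<beta>) xs)"
proof -
  have "(\<integral>\<^sup>+x. ennreal (spectral_sum (\<lambda>s. log_kernel y (x - s)) xs) * indicator {\<alpha>..\<beta>} x \<partial>lborel)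
      = (\<integral>\<^sup>+x. (\<Sum>s\<in>spectrum (sites xs) (length xs). ennreal (log_kernel y (x - s)) * indicator {\<alpha>..\<beta>} x) \<partial>lborel)"
    unfolding spectral_sum_def sum_distrib_right[symmetric]
    using log_kernel_bounds(1)[OF y] by (subst sum_ennreal) auto
  also have "\<dots> = (\<Sum>s\<in>spectrum (sites xs) (length xs). ennreal (pi * y * smooth_indicator y \<alpha> \<beta> s))"
    by (subst nn_integral_sum) (auto simp: smooth_indicator_integral[OF y ab])
  also have "\<dots> = ennreal (pi * y * spectral_sum (smooth_indicator y \<alpha> \<beta>) xs)"
    unfolding spectral_sum_def using y ab smooth_indicator_nonneg[OF y ab]
    by (subst sum_ennreal) (auto simp only: sum_distrib_left intro!: mult_nonneg_nonneg pi_ge_zero)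
  finally show ?thesis .
qed

text \<open>Integrating the pointwise convergence of the differences of potentials over \<open>x \<in> [\<alpha>, \<beta>]\<close>, by
  dominated convergence and Tonelli's theorem, turns the kernels into smoothed indicator functions. This is the convergence of the expected
  eigenvalue distributions to \<open>N\<close>, tested on the functions that matter here.\<close>

lemma ids_smooth_window_limit:
  fixes D :: "real pmf" and N :: "real \<Rightarrow> real"
  assumes prob: "real_distribution (interval_measure N)"
    and y: "y > 0" and ab: "\<alpha> \<le> \<beta>"
    and lim: "\<And>x. (\<lambda>n. 1 / real n * (\<integral>xs. spectral_sum (\<lambda>s. log_kernel y (x - s)) xs \<partial>replicate_pmf n D))
       \<longlonglongrightarrow> (\<integral>s. log_kernel y (x - s) \<partial>interval_measure N)"
  shows "(\<lambda>n. \<integral>\<^sup>+xs. ennreal (1 / real n * spectral_sum (smooth_indicator y \<alpha> \<beta>) xs) \<partial>replicate_pmf n D)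
       \<longlonglongrightarrow> (\<integral>\<^sup>+s. ennreal (smooth_indicator y \<alpha> \<beta> s) \<partial>interval_measure N)"
proof -
  interpret N: real_distribution "interval_measure N" by fact
  let ?W = "\<lambda>n. replicate_pmf n D"
  define S where "S x xs = spectral_sum (\<lambda>s. log_kernel y (x - s)) xs" for x xs
  have S0: "0 \<le> S x xs" "S x xs \<le> real (length xs) * ln 2" for x xs
    unfolding S_def by (rule spectral_sum_bounds[OF y])+
  have Smeas [measurable]: "(\<lambda>x. S x xs) \<in> borel_measurable borel" for xs
    unfolding S_def spectral_sum_def by measurable
  have Sn: "1 / real n * S x xs \<le> ln 2" "0 \<le> 1 / real n * S x xs" if "xs \<in> set_pmf (?W n)" for n x xs
    using that S0[of x xs] by (auto simp: set_replicate_pmf divide_simps mult.commute)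
  have intS: "integrable (?W n) (\<lambda>xs. 1 / real n * S x xs)" for n x
    using Sn S0(1) by (intro measure_pmf.integrable_const_bound[where B="ln 2"] AE_pmfI) auto
  define T where "T n x = (\<integral>\<^sup>+xs. ennreal (1 / real n * S x xs) \<partial>?W n)" for n x
  have T_eq: "T n x = ennreal (1 / real n * (\<integral>xs. S x xs \<partial>?W n))" for n x
    unfolding T_def using Sn(2)
    by (subst nn_integral_eq_integral[OF intS]) (auto intro: AE_pmfI)
  have T_le: "T n x \<le> ennreal (ln 2)" for n x
  proof -
    have "T n x \<le> (\<integral>\<^sup>+xs. ennreal (ln 2) \<partial>?W n)"
      unfolding T_def using Sn(1) by (intro nn_integral_mono_AE AE_pmfI ennreal_leI) auto
    then show ?thesis by (simp add: measure_pmf.emeasure_space_1)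
  qed
  have Tmeas [measurable]: "T n \<in> borel_measurable lborel" for n
    unfolding T_def by (rule measurable_nn_integral_pmf) simp
  define H where "H x = (\<integral>s. log_kernel y (x - s) \<partial>interval_measure N)" for x
  have H_eq: "ennreal (H x) = (\<integral>\<^sup>+s. ennreal (log_kernel y (x - s)) \<partial>interval_measure N)" for x
    unfolding H_def using log_kernel_bounds[OF y]
    by (intro nn_integral_eq_integral[symmetric] N.integrable_const_bound[where B="ln 2"]) auto
  have TH: "(\<lambda>n. T n x) \<longlonglongrightarrow> ennreal (H x)" for x
    unfolding T_eq using lim[of x] unfolding S_def[symmetric] H_def[symmetric] by (rule tendsto_ennrealI)
  have Hmeas [measurable]: "(\<lambda>x. ennreal (H x)) \<in> borel_measurable lborel"
    unfolding H_eq by measurable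
  have "(\<lambda>n. \<integral>\<^sup>+x. T n x * indicator {\<alpha>..\<beta>} x \<partial>lborel) \<longlonglongrightarrow> (\<integral>\<^sup>+x. ennreal (H x) * indicator {\<alpha>..\<beta>} x \<partial>lborel)"
  proof (rule nn_integral_dominated_convergence[where w="\<lambda>x. ennreal (ln 2) * indicator {\<alpha>..\<beta>} x"])
    show "AE x in lborel. T n x * indicator {\<alpha>..\<beta>} x \<le> ennreal (ln 2) * indicator {\<alpha>..\<beta>} x" for n
      using T_le by (intro AE_I2 mult_right_mono) auto
    show "(\<integral>\<^sup>+x. ennreal (ln 2) * indicator {\<alpha>..\<beta>} x \<partial>lborel) < \<infinity>"
      using ab by (simp add: nn_integral_cmult ennreal_mult_less_top)
    show "AE x in lborel. (\<lambda>n. T n x * indicator {\<alpha>..\<beta>} x) \<longlonglongrightarrow> ennreal (H x) * indicator {\<alpha>..\<beta>} x"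
      using TH by (intro AE_I2) (auto simp: indicator_def)
  qed measurable
  moreover have "(\<integral>\<^sup>+x. T n x * indicator {\<alpha>..\<beta>} x \<partial>lborel)
      = ennreal (pi * y) * (\<integral>\<^sup>+xs. ennreal (1 / real n * spectral_sum (smooth_indicator y \<alpha> \<beta>) xs) \<partial>?W n)" for n
  proof -
    have "(\<integral>\<^sup>+x. T n x * indicator {\<alpha>..\<beta>} x \<partial>lborel)
        = (\<integral>\<^sup>+x. \<integral>\<^sup>+xs. ennreal (1 / real n * S x xs) * indicator {\<alpha>..\<beta>} x \<partial>?W n \<partial>lborel)"
      unfolding T_def by (simp add: nn_integral_multc)
    also have "\<dots> = (\<integral>\<^sup>+xs. \<integral>\<^sup>+x. ennreal (1 / real n * S x xs) * indicator {\<alpha>..\<beta>} x \<partial>lborel \<partial>?W n)"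
      by (rule nn_integral_pmf_swap(2)) simp
    also have "\<dots> = (\<integral>\<^sup>+xs. ennreal (pi * y) * ennreal (1 / real n * spectral_sum (smooth_indicator y \<alpha> \<beta>) xs) \<partial>?W n)"
    proof (intro nn_integral_cong)
      fix xs
      have g0: "0 \<le> spectral_sum (smooth_indicator y \<alpha> \<beta>) xs"
        unfolding spectral_sum_def by (intro sum_nonneg smooth_indicator_nonneg[OF y ab])
      have "(\<integral>\<^sup>+x. ennreal (1 / real n * S x xs) * indicator {\<alpha>..\<beta>} x \<partial>lborel)
          = (\<integral>\<^sup>+x. ennreal (1 / real n) * (ennreal (S x xs) * indicator {\<alpha>..\<beta>} x) \<partial>lborel)"
        using S0(1) by (intro nn_integral_cong) (subst ennreal_mult, auto simp: mult.assoc)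
      also have "\<dots> = ennreal (1 / real n) * ennreal (pi * y * spectral_sum (smooth_indicator y \<alpha> \<beta>) xs)"
        using nn_integral_spectral_sum[OF y ab, of xs, folded S_def]
        by (subst nn_integral_cmult) auto
      also have "\<dots> = ennreal (pi * y) * ennreal (1 / real n * spectral_sum (smooth_indicator y \<alpha> \<beta>) xs)"
        using y g0 by (simp add: ennreal_mult[symmetric] del: ennreal_mult)
      finally show "(\<integral>\<^sup>+x. ennreal (1 / real n * S x xs) * indicator {\<alpha>..\<beta>} x \<partial>lborel)
          = ennreal (pi * y) * ennreal (1 / real n * spectral_sum (smooth_indicator y \<alpha> \<beta>) xs)" .
    qed
    finally show ?thesis by (simp add: nn_integral_cmult)
  qed
  moreover have "(\<integral>\<^sup>+x. ennreal (H x) * indicator {\<alpha>..\<beta>} x \<partial>lborel)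
      = ennreal (pi * y) * (\<integral>\<^sup>+s. ennreal (smooth_indicator y \<alpha> \<beta> s) \<partial>interval_measure N)"
  proof -
    interpret P: pair_sigma_finite "interval_measure N" lborel
      by (intro pair_sigma_finite.intro N.sigma_finite_measure_axioms lborel.sigma_finite_measure_axioms)
    have m: "(\<lambda>z. ennreal (log_kernel y (snd z - fst z)) * indicator {\<alpha>..\<beta>} (snd z)) \<in> borel_measurable (interval_measure N \<Otimes>\<^sub>M lborel)"
      by measurable
    have "(\<integral>\<^sup>+x. ennreal (H x) * indicator {\<alpha>..\<beta>} x \<partial>lborel)
        = (\<integral>\<^sup>+x. \<integral>\<^sup>+s. ennreal (log_kernel y (x - s)) * indicator {\<alpha>..\<beta>} x \<partial>interval_measure N \<partial>lborel)"
      unfolding H_eq by (simp add: nn_integral_multc)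
    also have "\<dots> = (\<integral>\<^sup>+s. \<integral>\<^sup>+x. ennreal (log_kernel y (x - s)) * indicator {\<alpha>..\<beta>} x \<partial>lborel \<partial>interval_measure N)"
      using P.Fubini[OF m] by simp
    also have "\<dots> = (\<integral>\<^sup>+s. ennreal (pi * y) * ennreal (smooth_indicator y \<alpha> \<beta> s) \<partial>interval_measure N)"
      using y smooth_indicator_nonneg[OF y ab]
      by (simp add: smooth_indicator_integral[OF y ab] ennreal_mult)
    also have "\<dots> = ennreal (pi * y) * (\<integral>\<^sup>+s. ennreal (smooth_indicator y \<alpha> \<beta> s) \<partial>interval_measure N)"
      by (subst nn_integral_cmult) (auto simp: smooth_indicator_def smooth_step_def)
    finally show ?thesis .
  qed
  ultimately have L: "(\<lambda>n. ennreal (pi * y) * (\<integral>\<^sup>+xs. ennreal (1 / real n * spectral_sum (smooth_indicator y \<alpha> \<beta>) xs) \<partial>?W n))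
      \<longlonglongrightarrow> ennreal (pi * y) * (\<integral>\<^sup>+s. ennreal (smooth_indicator y \<alpha> \<beta> s) \<partial>interval_measure N)"
    by simp
  have c: "ennreal (1 / (pi * y)) * (ennreal (pi * y) * X) = X" for X
  proof -
    have "ennreal (1 / (pi * y)) * ennreal (pi * y) = 1"
      using y by (simp add: ennreal_mult[symmetric] del: ennreal_mult)
    then show ?thesis by (simp add: mult.assoc[symmetric])
  qed
  show ?thesis
    using ennreal_tendsto_cmult[OF _ L, of "ennreal (1 / (pi * y))"] unfolding c by simp
qed

text \<open>On average a fraction \<open>q\<close> of the aligned positions carries a resonant block, every block contributes \<open>1/8\<close> to
  the smoothed eigenvalue count, and there is one position per five sites: this gives \<open>q / 40\<close>.
  The tails of the smoothed indicator cost an arbitrary \<open>\<eta> > 0\<close>.\<close>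

lemma ids_window_lower_bound:
  fixes D :: "real pmf" and N :: "real \<Rightarrow> real"
  assumes prob: "real_distribution (interval_measure N)" and cont: "continuous_on UNIV N" and mono: "mono N"
    and lim: "\<And>x y. y > 0 \<Longrightarrow> (\<lambda>n. 1 / real n * (\<integral>xs. spectral_sum (\<lambda>s. log_kernel y (x - s)) xs \<partial>replicate_pmf n D))
       \<longlonglongrightarrow> (\<integral>s. log_kernel y (x - s) \<partial>interval_measure N)"
    and E: "E > 0" and d: "U - E \<ge> 40" and V: "V \<ge> 50 * E" "V \<ge> 50"
  shows "pmf (replicate_pmf 5 D) [U, - V, E, V, U] / 40 \<le> N (E + 1 / (2 * V)) - N (E - 1 / (2 * V))"
proof (rule field_le_epsilon)
  fix \<eta> :: real assume \<eta>: "\<eta> > 0"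
  interpret N: real_distribution "interval_measure N" by fact
  let ?b = "[U, V, E, - V, U]"
  define q where "q = pmf (replicate_pmf 5 D) [U, - V, E, V, U]"
  define h where "h = 1 / (2 * V)"
  \<comment> \<open>Midway between the half-width \<open>1 / (4 V)\<close> that the test vectors control and the half-width \<open>h\<close>.\<close>
  define \<rho> where "\<rho> = 3 / (8 * V)"
  have Vpos: "V > 0" using V by simp
  have "0 < 1 / (4 * V)" "1 / (4 * V) < \<rho>" "\<rho> < h"
    using Vpos by (auto simp: \<rho>_def h_def field_simps)
  from smooth_indicator_sharp[OF this \<eta>, of E] obtain y where y: "y > 0"
    and inner: "\<And>s. \<bar>s - E\<bar> \<le> 1 / (4 * V) \<Longrightarrow> smooth_indicator y (E - \<rho>) (E + \<rho>) s \<ge> 1 / 2"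
    and outer: "\<And>s. \<bar>s - E\<bar> \<ge> h \<Longrightarrow> smooth_indicator y (E - \<rho>) (E + \<rho>) s \<le> \<eta>"
    by blast
  let ?g = "smooth_indicator y (E - \<rho>) (E + \<rho>)"
  have \<rho>: "E - \<rho> \<le> E + \<rho>" using Vpos by (simp add: \<rho>_def)
  have g0: "?g s \<ge> 0" for s by (rule smooth_indicator_nonneg[OF y \<rho>])
  have h0: "h > 0" using Vpos by (simp add: h_def)
  define X where "X n = (\<integral>\<^sup>+xs. ennreal (1 / real n * spectral_sum ?g xs) \<partial>replicate_pmf n D)" for n
  let ?I = "\<integral>\<^sup>+s. ennreal (?g s) \<partial>interval_measure N"
  have X: "X \<longlonglongrightarrow> ?I"
    unfolding X_def by (rule ids_smooth_window_limit[OF prob y \<rho> lim[OF y]])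
  have "X (5 * Suc m) \<ge> ennreal (q / 40)" for m
  proof -
    let ?n = "5 * Suc m"
    have "ennreal (q / 40) = ennreal (1 / (8 * real ?n)) * ennreal (real (Suc m) * q)"
    proof -
      have "q / 40 = 1 / (8 * real ?n) * (real (Suc m) * q)" by (simp add: field_simps)
      then show ?thesis by (simp only:) (rule ennreal_mult, auto simp: q_def)
    qed
    also have "ennreal (real (Suc m) * q) = (\<integral>\<^sup>+xs. ennreal (card (block_positions ?b (Suc m) xs)) \<partial>replicate_pmf ?n D)"
    proof -
      have "length ?b = 5" "rev ?b = [U, - V, E, V, U]" by simp_all
      then show ?thesis
        using expected_block_positions[of ?b "Suc m" D] unfolding q_def by (simp only:)
    qed
    also have "ennreal (1 / (8 * real ?n)) * \<dots>
        = (\<integral>\<^sup>+xs. ennreal (1 / (8 * real ?n)) * ennreal (card (block_positions ?b (Suc m) xs)) \<partial>replicate_pmf ?n D)"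
      by (simp add: nn_integral_cmult)
    also have "\<dots> \<le> X ?n"
      unfolding X_def
    proof (intro nn_integral_mono_AE AE_pmfI)
      fix xs assume "xs \<in> set_pmf (replicate_pmf ?n D)"
      then have "length xs = ?n" by (auto simp: set_replicate_pmf)
      from spectral_mass_ge_blocks[OF E d V this, of ?g, OF g0 inner]
      have "real (card (block_positions ?b (Suc m) xs)) / 8 \<le> spectral_sum ?g xs"
        unfolding spectral_sum_def by simp
      then have "1 / real ?n * (real (card (block_positions ?b (Suc m) xs)) / 8) \<le> 1 / real ?n * spectral_sum ?g xs"
        by (intro mult_left_mono) auto
      then have "1 / (8 * real ?n) * real (card (block_positions ?b (Suc m) xs)) \<le> 1 / real ?n * spectral_sum ?g xs"
        by (simp add: mult.commute)
      then show "ennreal (1 / (8 * real ?n)) * ennreal (card (block_positions ?b (Suc m) xs))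
          \<le> ennreal (1 / real ?n * spectral_sum ?g xs)"
        by (subst ennreal_mult[symmetric]) (auto intro!: ennreal_leI)
    qed
    finally show ?thesis .
  qed
  moreover have "(\<lambda>m. X (5 * Suc m)) \<longlonglongrightarrow> ?I"
    using LIMSEQ_subseq_LIMSEQ[OF X, of "\<lambda>m. 5 * Suc m"] by (simp add: strict_mono_def o_def)
  ultimately have "ennreal (q / 40) \<le> ?I"
    by (intro LIMSEQ_le_const) auto
  also have "\<dots> \<le> (\<integral>\<^sup>+s. indicator {E - h..E + h} s + ennreal \<eta> \<partial>interval_measure N)"
  proof (intro nn_integral_mono)
    fix s
    show "ennreal (?g s) \<le> indicator {E - h..E + h} s + ennreal \<eta>"
    proof (cases "s \<in> {E - h..E + h}")
      case True
      have "ennreal (?g s) \<le> 1" using smooth_indicator_le_1 by simp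
      then show ?thesis using True by (simp add: add_increasing2)
    next
      case False
      then have "?g s \<le> \<eta>" by (intro outer) auto
      then show ?thesis using False by (simp add: ennreal_leI)
    qed
  qed
  also have "\<dots> = emeasure (interval_measure N) {E - h..E + h} + ennreal \<eta>"
    using N.emeasure_space_1 by (simp add: nn_integral_add)
  also have "emeasure (interval_measure N) {E - h..E + h} = ennreal (N (E + h) - N (E - h))"
    using h0 mono cont by (intro emeasure_interval_measure_Icc) (auto simp: mono_def)
  also have "ennreal (N (E + h) - N (E - h)) + ennreal \<eta> = ennreal (N (E + h) - N (E - h) + \<eta>)"
    using \<eta> monoD[OF mono, of "E - h" "E + h"] h0 by (intro ennreal_plus[symmetric]) auto
  finally show "pmf (replicate_pmf 5 D) [U, - V, E, V, U] / 40 \<le> N (E + 1 / (2 * V)) - N (E - 1 / (2 * V)) + \<eta>"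
    using \<eta> monoD[OF mono, of "E - h" "E + h"] h0 unfolding q_def h_def[symmetric]
    by (subst (asm) ennreal_le_iff) auto
qed

section \<open>The law of the potential\<close>

lemma potential_law_exists:
  fixes p v :: "nat \<Rightarrow> real"
  assumes pos: "\<And>n. n \<ge> 1 \<Longrightarrow> p n > 0" and sum: "(\<lambda>n. p (Suc n)) sums 1"
  obtains D :: "real pmf" where
    "\<And>t. schroedinger_measure p v t = distr (measure_pmf D) borel (\<lambda>a. schroedinger_matrix (of_real a - t))"
    "\<And>n. n \<ge> 1 \<Longrightarrow> pmf D (v n) \<ge> p n / 2" "\<And>n. n \<ge> 1 \<Longrightarrow> pmf D (- v n) \<ge> p n / 2"
proof -
  have pS: "p (Suc n) > 0" for n using pos by simp
  \<comment> \<open>Index \<open>n\<close> of \<open>w\<close> stands for the values \<open>\<plusminus>v (Suc n)\<close> of the potential.\<close>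
  define w where "w = embed_pmf (\<lambda>n. p (Suc n))"
  have "(\<integral>\<^sup>+n. ennreal (p (Suc n)) \<partial>count_space UNIV) = 1"
    using suminf_ennreal_eq[OF less_imp_le[OF pS] sum] by (simp add: nn_integral_count_space_nat)
  then have w: "pmf w n = p (Suc n)" for n
    unfolding w_def by (intro pmf_embed_pmf) (auto simp: less_imp_le pS)
  define f where "f = (\<lambda>(n, b). if b then v (Suc n) else - v (Suc n))"
  define W where "W = pair_pmf w (bernoulli_pmf (1 / 2))"
  define D where "D = map_pmf f W"
  have pmfD: "pmf D (f (n, b)) \<ge> p (Suc n) / 2" for n b
  proof -
    have "p (Suc n) / 2 = pmf W (n, b)" by (cases b) (auto simp: W_def pmf_pair w)
    also have "\<dots> = measure W {(n, b)}" by (simp add: measure_pmf_single)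
    also have "\<dots> \<le> measure W (f -` {f (n, b)})" by (intro measure_pmf.finite_measure_mono) auto
    finally show ?thesis by (simp add: D_def pmf_map)
  qed
  show ?thesis
  proof (rule that[of D])
    fix t
    show "schroedinger_measure p v t = distr (measure_pmf D) borel (\<lambda>a. schroedinger_matrix (of_real a - t))" (is "_ = distr _ _ ?S")
    proof (rule measure_eqI)
      fix A assume "A \<in> sets (schroedinger_measure p v t)"
      then have A: "A \<in> sets borel" by simp
      have "emeasure (distr (measure_pmf D) borel ?S) A = (\<integral>\<^sup>+a. indicator A (?S a) \<partial>D)"
        using A by (subst nn_integral_indicator[symmetric], simp, subst nn_integral_distr) auto
      also have "\<dots> = (\<integral>\<^sup>+n. \<integral>\<^sup>+b. indicator A (?S (f (n, b))) \<partial>bernoulli_pmf (1 / 2) \<partial>w)"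
        unfolding D_def W_def by (simp add: nn_integral_pair_pmf')
      also have "\<dots> = (\<integral>\<^sup>+n. ennreal (1 / 2) * indicator A (schroedinger_matrix (of_real (v (Suc n)) - t))
          + ennreal (1 / 2) * indicator A (schroedinger_matrix (- of_real (v (Suc n)) - t)) \<partial>w)"
        by (subst nn_integral_bernoulli_pmf) (auto simp: f_def mult.commute)
      also have "\<dots> = (\<Sum>n. ennreal (p (Suc n)) * (ennreal (1 / 2) * indicator A (schroedinger_matrix (of_real (v (Suc n)) - t))
          + ennreal (1 / 2) * indicator A (schroedinger_matrix (- of_real (v (Suc n)) - t))))"
        by (simp add: nn_integral_measure_pmf nn_integral_count_space_nat w)
      also have "\<dots> = emeasure (schroedinger_measure p v t) A"
      proof -
        have "ennreal (p (Suc n)) * (ennreal (1 / 2) * x + ennreal (1 / 2) * z)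
            = ennreal (p (Suc n) / 2) * x + ennreal (p (Suc n) / 2) * z" for n x z
        proof -
          have "ennreal (p (Suc n)) * ennreal (1 / 2) = ennreal (p (Suc n) / 2)"
            using less_imp_le[OF pS[of n]] by (subst ennreal_mult[symmetric]) auto
          then show ?thesis by (simp add: distrib_left mult.assoc[symmetric])
        qed
        then show ?thesis unfolding emeasure_schroedinger_measure[OF A] by simp
      qed
      finally show "emeasure (schroedinger_measure p v t) A = emeasure (distr (measure_pmf D) borel ?S) A" ..
    qed simp
  next
    fix n :: nat assume "n \<ge> 1"
    then obtain m where n: "n = Suc m" by (cases n) auto
    show "pmf D (v n) \<ge> p n / 2" "pmf D (- v n) \<ge> p n / 2"
      using pmfD[of m True] pmfD[of m False] by (simp_all add: n f_def)
  qed
qed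

text \<open>Since \<open>r \<le> \<psi> r\<close>, the \<open>\<psi>\<close>-moment bounds the part of the logarithmic moment where the logarithm exceeds \<open>1\<close>;
  the remaining part is at most \<open>1\<close>.\<close>

lemma log_moment_finite:
  fixes D :: "real pmf"
  assumes law: "M = distr (measure_pmf D) borel (\<lambda>a. schroedinger_matrix (of_real a - t))"
    and \<psi>: "\<And>r. r > 1 \<Longrightarrow> r \<le> \<psi> r" and fin: "moment \<psi> M < \<infinity>"
  shows "(\<integral>\<^sup>+a. ennreal (ln (opnorm (schroedinger_matrix (of_real a - t)))) \<partial>D) < \<infinity>"
proof -
  let ?S = "\<lambda>a::real. schroedinger_matrix (of_real a - t)" and ?U = "{g. ln (opnorm g) > 1}"
  have U [measurable]: "?U \<in> sets borel" by measurable
  have "(\<integral>\<^sup>+a. ennreal (ln (opnorm (?S a))) \<partial>D) \<le> (\<integral>\<^sup>+a. 1 + ennreal (ln (opnorm (?S a))) * indicator ?U (?S a) \<partial>D)"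
    by (intro nn_integral_mono) (auto simp: indicator_def add_increasing)
  also have "\<dots> = 1 + (\<integral>\<^sup>+a. ennreal (ln (opnorm (?S a))) * indicator ?U (?S a) \<partial>D)"
    by (subst nn_integral_add) (auto simp: measure_pmf.emeasure_space_1)
  finally have le: "(\<integral>\<^sup>+a. ennreal (ln (opnorm (?S a))) \<partial>D)
      \<le> 1 + (\<integral>\<^sup>+a. ennreal (ln (opnorm (?S a))) * indicator ?U (?S a) \<partial>D)" .
  have "(\<integral>\<^sup>+a. ennreal (ln (opnorm (?S a))) * indicator ?U (?S a) \<partial>D)
      = (\<integral>\<^sup>+g. ennreal (ln (opnorm g)) * indicator ?U g \<partial>M)"
    unfolding law by (subst nn_integral_distr) auto
  also have "\<dots> \<le> moment \<psi> M"
    unfolding moment_def using \<psi> by (intro nn_integral_mono) (auto simp: indicator_def intro!: ennreal_leI)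
  also note fin
  finally have "1 + (\<integral>\<^sup>+a. ennreal (ln (opnorm (?S a))) * indicator ?U (?S a) \<partial>D) < \<infinity>" by simp
  with le show ?thesis by (rule le_less_trans)
qed

text \<open>The limit is the Lyapunov exponent at \<open>x + 2iy\<close> minus the one at \<open>x + iy\<close>, approximated through the
  eigenvalues of long random words on the left and expressed by the Thouless formula on the right.\<close>

lemma thouless_kernel_limit:
  fixes D :: "real pmf"
  assumes law: "\<And>t. schroedinger_measure p v t = distr (measure_pmf D) borel (\<lambda>a. schroedinger_matrix (of_real a - t))"
    and fin: "\<And>t. (\<integral>\<^sup>+a. ennreal (ln (opnorm (schroedinger_matrix (of_real a - t)))) \<partial>D) < \<infinity>"
    and N: "is_integrated_density_of_states p v N" and y: "y > 0"
  shows "(\<lambda>n. 1 / real n * (\<integral>xs. spectral_sum (\<lambda>s. log_kernel y (x - s)) xs \<partial>replicate_pmf n D))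
       \<longlonglongrightarrow> (\<integral>s. log_kernel y (x - s) \<partial>interval_measure N)"
proof -
  let ?t = "\<lambda>z. Complex x z" and ?P = "\<lambda>z xs. ln (cmod (transfer (Complex x z) xs $1$1))"
  have im: "Im (?t y) > 0" "Im (?t (2 * y)) > 0" using y by auto
  have th: "integrable (interval_measure N) (\<lambda>s. ln (cmod (t - of_real s)))"
    "lyapunov_exponent (schroedinger_measure p v t) = (\<integral>s. ln (cmod (t - of_real s)) \<partial>interval_measure N)" for t
    using N unfolding is_integrated_density_of_states_def by blast+
  have "(\<lambda>n. 1 / real n * (\<integral>xs. ?P (2 * y) xs \<partial>replicate_pmf n D) - 1 / real n * (\<integral>xs. ?P y xs \<partial>replicate_pmf n D))
     \<longlonglongrightarrow> lyapunov_exponent (schroedinger_measure p v (?t (2 * y))) - lyapunov_exponent (schroedinger_measure p v (?t y))"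
    unfolding law by (intro tendsto_diff ln_continuant_tendsto im fin)
  moreover have "1 / real n * (\<integral>xs. ?P (2 * y) xs \<partial>replicate_pmf n D) - 1 / real n * (\<integral>xs. ?P y xs \<partial>replicate_pmf n D)
      = 1 / real n * (\<integral>xs. spectral_sum (\<lambda>s. log_kernel y (x - s)) xs \<partial>replicate_pmf n D)" for n
    unfolding spectral_sum_log_kernel[OF y] right_diff_distrib[symmetric]
    by (subst Bochner_Integration.integral_diff) (auto intro!: integrable_ln_continuant im fin)
  moreover have "lyapunov_exponent (schroedinger_measure p v (?t (2 * y))) - lyapunov_exponent (schroedinger_measure p v (?t y))
      = (\<integral>s. log_kernel y (x - s) \<partial>interval_measure N)"
    unfolding th(2) log_kernel_eq[OF y] using th(1) by (intro Bochner_Integration.integral_diff[symmetric]) auto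
  ultimately show ?thesis by simp
qed

lemma ids_real_distribution:
  assumes "is_integrated_density_of_states p v N"
  shows "real_distribution (interval_measure N)"
  using assms unfolding is_integrated_density_of_states_def
  by (intro real_distribution_interval_measure)
    (auto simp: mono_def continuous_on_eq_continuous_within continuous_at_imp_continuous_at_within)

section \<open>Failure of the modulus of continuity\<close>

theorem theorem2p1:
  fixes \<phi> \<psi> :: "real \<Rightarrow> real" and p v :: "nat \<Rightarrow> real" and N :: "real \<Rightarrow> real"
  assumes "moment_profile \<phi>" and "moment_profile \<psi>"
    and "\<And>r. r > 1 \<Longrightarrow> r \<le> \<psi> r \<and> \<psi> r \<le> \<phi> r"
    and "\<And>n. n \<ge> 1 \<Longrightarrow> p n > 0"
    and "(\<lambda>n. p (Suc n)) sums 1"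
    and "0 < limsup (\<lambda>n. ereal (p (n - 1) / p n))"
    and "limsup (\<lambda>n. ereal (p (n - 1) / p n)) \<le> 1"
    and "\<And>n. n \<ge> 1 \<Longrightarrow> v n > 0"
    and "\<And>n. n \<ge> 1 \<Longrightarrow> v (n + 1) - v n > 4"
    and "filterlim v at_top sequentially"
    and "filterlim (\<lambda>n. v n - v (n - 1)) at_top sequentially"
    and "\<And>m::real. m > 0 \<Longrightarrow> (\<Squnion>t\<in>{t. cmod t \<le> m}. moment \<psi> (schroedinger_measure p v t)) < \<infinity>"
    and "filterlim (\<lambda>n. p n * \<phi> (ln (v n))) at_top sequentially"
    and "is_integrated_density_of_states p v N"
  shows "\<not> has_local_modulus N (profile_modulus 2 \<phi>)"
proof
  assume modulus: "has_local_modulus N (profile_modulus 2 \<phi>)"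
  note p = assms(4) and v = assms(8) and v_top = assms(10) and ids = assms(14)
  obtain D where law: "\<And>t. schroedinger_measure p v t = distr (measure_pmf D) borel (\<lambda>a. schroedinger_matrix (of_real a - t))"
    and pmf_v: "\<And>n. n \<ge> 1 \<Longrightarrow> pmf D (v n) \<ge> p n / 2" "\<And>n. n \<ge> 1 \<Longrightarrow> pmf D (- v n) \<ge> p n / 2"
    using potential_law_exists[of p v, OF p assms(5)] by blast
  have fin: "(\<integral>\<^sup>+a. ennreal (ln (opnorm (schroedinger_matrix (of_real a - t)))) \<partial>D) < \<infinity>" for t
  proof (rule log_moment_finite[OF law])
    show "r \<le> \<psi> r" if "r > 1" for r using assms(3)[OF that] by blast
    have "moment \<psi> (schroedinger_measure p v t) \<le> (\<Squnion>s\<in>{s. cmod s \<le> cmod t + 1}. moment \<psi> (schroedinger_measure p v s))"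
      by (intro SUP_upper) auto
    also have "\<dots> < \<infinity>" by (intro assms(12)) (simp add: add_nonneg_pos)
    finally show "moment \<psi> (schroedinger_measure p v t) < \<infinity>" .
  qed
  have cont: "continuous_on UNIV N" "mono N"
    using ids unfolding is_integrated_density_of_states_def by auto
  define E where "E = v 1"
  have E: "E > 0" using v[of 1] by (simp add: E_def)
  have "eventually (\<lambda>n. v n \<ge> E + 40 \<and> n \<ge> 1) sequentially"
    using v_top by (auto simp: filterlim_at_top intro: eventually_conj eventually_ge_at_top)
  then obtain k where k: "v k - E \<ge> 40" "k \<ge> 1"
    by (auto simp: eventually_sequentially) (metis add.commute le_diff_eq linear)
  have window: "pmf (replicate_pmf 5 D) [v k, - v n, E, v n, v k] / 40
      \<le> N (E + 1 / (2 * v n)) - N (E - 1 / (2 * v n))" if "v n \<ge> 50 * E" "v n \<ge> 50" for n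
    by (rule ids_window_lower_bound[OF ids_real_distribution[OF ids] cont thouless_kernel_limit[OF law fin ids] E k(1) that])
  \<comment> \<open>The letters other than \<open>\<plusminus>v n\<close> cost a constant; \<open>160\<close> is \<open>40\<close> times the two factors \<open>1/2\<close> of \<open>\<plusminus>v n\<close>.\<close>
  define c where "c = (p k / 2) * (p k / 2) * (p 1 / 2) / 160"
  have c: "c > 0" using p[of k] p[of 1] k by (simp add: c_def)
  have block: "c * (p n)\<^sup>2 \<le> pmf (replicate_pmf 5 D) [v k, - v n, E, v n, v k] / 40" if n: "n \<ge> 1" for n
  proof -
    have "pmf (replicate_pmf 5 D) [v k, - v n, E, v n, v k]
        = pmf D (v k) * (pmf D (- v n) * (pmf D E * (pmf D (v n) * pmf D (v k))))"
      by (simp add: numeral_eq_Suc pmf_replicate_pmf_Cons del: replicate_pmf.simps(2))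
    moreover have "(p k / 2) * ((p n / 2) * ((p 1 / 2) * ((p n / 2) * (p k / 2)))) \<le> \<dots>"
      using n k p[of n] p[of k] p[of 1] pmf_v(1)[of k] pmf_v(1)[of n] pmf_v(2)[of n] pmf_v(1)[of 1]
      unfolding E_def by (intro mult_mono mult_nonneg_nonneg) auto
    ultimately show ?thesis by (simp add: c_def power2_eq_square mult_ac)
  qed
  from modulus obtain r C where r: "r > 0"
    and C: "\<And>x z. dist x E < r \<Longrightarrow> dist z E < r \<Longrightarrow> \<bar>N x - N z\<bar> \<le> C * profile_modulus 2 \<phi> (dist x z)"
    unfolding has_local_modulus_def by blast
  have "eventually (\<lambda>n. n \<ge> 1 \<and> v n \<ge> max (50 * E) (max 50 (1 / r)) \<and> p n * \<phi> (ln (v n)) \<ge> max 1 (C / c + 1)) sequentially"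
    using v_top assms(13) unfolding filterlim_at_top by (intro eventually_conj eventually_ge_at_top) blast+
  then obtain n where n: "n \<ge> 1" and V: "v n \<ge> 50 * E" "v n \<ge> 50" "v n \<ge> 1 / r"
    and big: "p n * \<phi> (ln (v n)) \<ge> 1" "p n * \<phi> (ln (v n)) \<ge> C / c + 1"
    by (auto simp: eventually_sequentially)
  let ?\<Phi> = "\<phi> (ln (v n))" and ?h = "1 / (2 * v n)"
  have vpos: "v n > 0" using V by simp
  have "1 < ln (v n)"
  proof -
    have "exp 1 < v n" using exp_le V by linarith
    then have "ln (exp 1) < ln (v n)" using vpos by (subst ln_less_cancel_iff) auto
    then show ?thesis by simp
  qed
  then have \<Phi>: "?\<Phi> > 0" using assms(1) by (simp add: moment_profile_def)
  have "1 / r \<le> v n" by fact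
  then have "1 \<le> v n * r" using r by (simp add: field_simps)
  then have hr: "?h < r" using vpos by (simp add: field_simps)
  have "c * (p n)\<^sup>2 \<le> N (E + ?h) - N (E - ?h)"
    using block[OF n] window[OF V(1,2)] by linarith
  also have "\<dots> \<le> C * profile_modulus 2 \<phi> (dist (E + ?h) (E - ?h))"
    using C[of "E + ?h" "E - ?h"] hr vpos by (simp add: dist_real_def)
  also have "dist (E + ?h) (E - ?h) = 1 / v n" using vpos by (simp add: dist_real_def field_simps)
  also have "profile_modulus 2 \<phi> (1 / v n) = 1 / ?\<Phi>\<^sup>2"
    using vpos \<Phi> by (simp add: profile_modulus_def powr_minus_divide)
  finally have "c * (p n * ?\<Phi>)\<^sup>2 \<le> C" using \<Phi> by (simp add: field_simps power_mult_distrib)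
  moreover have "p n * ?\<Phi> \<le> (p n * ?\<Phi>)\<^sup>2"
    using mult_left_mono[OF big(1), of "p n * ?\<Phi>"] big(1) by (simp add: power2_eq_square)
  ultimately have "c * (p n * ?\<Phi>) \<le> C" using c mult_left_mono[of "p n * ?\<Phi>" "(p n * ?\<Phi>)\<^sup>2" c] by linarith
  moreover have "c * (p n * ?\<Phi>) \<ge> c * (C / c + 1)" using big(2) c by (intro mult_left_mono) auto
  moreover have "c * (C / c + 1) = C + c" using c by (simp add: field_simps)
  ultimately show False using c by linarith
qed

end
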